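(* Let $\mathbf{X}=(X_1,\ldots,X_N)^\intercal$ satisfy the standing assumptions (1)-(3) listed in the context, let $\mathbf{p}\in\mathbb{N}_0^N$, let $\boldsymbol{\Xi}=\{\boldsymbol{\xi}_1,\ldots,\boldsymbol{\xi}_N\}$ with $\boldsymbol{\xi}_k$ a $(p_k+1)$-open knot sequence on $[a_k,b_k]$, let $1\le S\le N$, and let $y(\mathbf{X})\in L^2(\Omega,\mathcal{F},\mathbb{P})$. Then the $S$-variate SDD approximation $y_{S,\mathbf{p},\boldsymbol{\Xi}}(\mathbf{X})$ of $y(\mathbf{X})$ has mean \[ \mathbb{E}\left[y_{S,\mathbf{p},\boldsymbol{\Xi}}(\mathbf{X})\right]=y_\emptyset=\mathbb{E}\left[y(\mathbf{X})\right] \] and variance \[ \operatorname{var}\left[y_{S,\mathbf{p},\boldsymbol{\Xi}}(\mathbf{X})\right]=\sum_{\substack{\emptyset\neq u\subseteq\{1,\ldots,N\}\\1\le|u|\le S}}\ \sum_{\mathbf{i}_u\in\bar{\mathcal{I}}_{u,\mathbf{n}_u}}\left(C^u_{\mathbf{i}_u,\mathbf{p}_u,\boldsymbol{\Xi}_u}\right)^2\le\operatorname{var}\left[y(\mathbf{X})\right]. \]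
   Context: Notation: $\mathbb{N}=\{1,2,\ldots\}$, $\mathbb{N}_0=\mathbb{N}\cup\{0\}$. $(\Omega,\mathcal{F},\mathbb{P})$ is a probability space with expectation $\mathbb{E}$; for $k=1,\ldots,N$ ($N\in\mathbb{N}$), $[a_k,b_k]\subset\mathbb{R}$ is a finite interval with $a_k<b_k$; $\mathbb{A}^N=\prod_{k=1}^N[a_k,b_k]$ with Borel $\sigma$-algebra $\mathcal{B}^N$; $\mathbf{X}:(\Omega,\mathcal{F})\to(\mathbb{A}^N,\mathcal{B}^N)$. Standing assumptions on $\mathbf{X}$: (1) $X_1,\ldots,X_N$ are statistically independent, not necessarily identically distributed. (2) Each $X_k$ is defined on the bounded interval $[a_k,b_k]$, hence has finite moments of all orders. (3) Each $X_k$ has an absolutely continuous marginal distribution function and a continuous marginal probability density function $f_{X_k}$ with bounded support $[a_k,b_k]$. Hence $\mathbf{X}$ has joint density $f_{\mathbf{X}}(\mathbf{x})=\prod_{k=1}^N f_{X_k}(x_k)$ supported on $\mathbb{A}^N$. For $\emptyset\neq u=\{k_1,\ldots,k_{|u|}\}\subseteq\{1,\ldots,N\}$: $\mathbf{X}_u=(X_{k_1},\ldots,X_{k_{|u|}})^\intercal$, $\mathbf{x}_u=(x_{k_1},\ldots,x_{k_{|u|}})$, $\mathbf{p}_u=(p_k)_{k\in u}$, $\boldsymbol{\Xi}_u=\{\boldsymbol{\xi}_k\}_{k\in u}$, $\mathbf{n}_u=(n_k)_{k\in u}$. Knots: for $n_k>p_k\ge0$, a $(p_k+1)$-open knot sequence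 on $[a_k,b_k]$ is a non-decreasing sequence $\boldsymbol{\xi}_k=\{\xi_{k,i}\}_{i=1}^{n_k+p_k+1}$ with distinct values $a_k=\zeta_{k,1}<\cdots<\zeta_{k,r_k}=b_k$ of multiplicities $m_{k,1}=m_{k,r_k}=p_k+1$ and $1\le m_{k,j}\le p_k+1$ for $1<j<r_k$. B-splines: $B^k_{i,0,\boldsymbol{\xi}_k}(x)=1$ if $\xi_{k,i}\le x<\xi_{k,i+1}$ and $0$ otherwise; for $p\ge1$, $B^k_{i,p,\boldsymbol{\xi}_k}(x)=\frac{x-\xi_{k,i}}{\xi_{k,i+p}-\xi_{k,i}}B^k_{i,p-1,\boldsymbol{\xi}_k}(x)+\frac{\xi_{k,i+p+1}-x}{\xi_{k,i+p+1}-\xi_{k,i+1}}B^k_{i+1,p-1,\boldsymbol{\xi}_k}(x)$, with $0/0:=0$. Orthonormalized B-splines: let $\mathbf{P}_k(x_k)=(1,B^k_{2,p_k,\boldsymbol{\xi}_k}(x_k),\ldots,B^k_{n_k,p_k,\boldsymbol{\xi}_k}(x_k))^\intercal$, let $\mathbf{G}_k=\mathbb{E}[\mathbf{P}_k(X_k)\mathbf{P}_k^\intercal(X_k)]$ (symmetric positive-definite), with Cholesky factorization $\mathbf{G}_k=\mathbf{Q}_k\mathbf{Q}_k^\intercal$, $\mathbf{Q}_k$ lower-triangular with positive diagonal. Then $\boldsymbol{\psi}_k(x_k)=\mathbf{Q}_k^{-1}\mathbf{P}_k(x_k)$ has components $\psi^k_{i,p_k,\boldsymbol{\xi}_k}(x_k)$,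 $i=1,\ldots,n_k$. Multivariate splines: $\bar{\mathcal{I}}_{u,\mathbf{n}_u}=\{\mathbf{i}_u=(i_{k_1},\ldots,i_{k_{|u|}}):2\le i_{k_l}\le n_{k_l},\ 1\le l\le|u|\}$ and $\Psi^u_{\mathbf{i}_u,\mathbf{p}_u,\boldsymbol{\Xi}_u}(\mathbf{x}_u)=\prod_{k\in u}\psi^k_{i_k,p_k,\boldsymbol{\xi}_k}(x_k)$. Here $L^2(\Omega,\mathcal{F},\mathbb{P})$ denotes the Hilbert space of random variables of the form $y(\mathbf{X})$, $y:\mathbb{A}^N\to\mathbb{R}$ measurable, with $\mathbb{E}[y(\mathbf{X})^2]<\infty$. $S$-variate (truncated) SDD approximation of $y(\mathbf{X})$: $y_{S,\mathbf{p},\boldsymbol{\Xi}}(\mathbf{X})=y_\emptyset+\sum_{\emptyset\neq u\subseteq\{1,\ldots,N\},\,1\le|u|\le S}\ \sum_{\mathbf{i}_u\in\bar{\mathcal{I}}_{u,\mathbf{n}_u}}C^u_{\mathbf{i}_u,\mathbf{p}_u,\boldsymbol{\Xi}_u}\Psi^u_{\mathbf{i}_u,\mathbf{p}_u,\boldsymbol{\Xi}_u}(\mathbf{X}_u)$ with $y_\emptyset=\mathbb{E}[y(\mathbf{X})]$ and $C^u_{\mathbf{i}_u,\mathbf{p}_u,\boldsymbol{\Xi}_u}=\mathbb{E}[y(\mathbf{X})\Psi^u_{\mathbf{i}_u,\mathbf{p}_u,\boldsymbol{\Xi}_u}(\mathbf{X}_u)]$. *)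

theory Defs
  imports "HOL-Probability.Probability" "Jordan_Normal_Form.Gauss_Jordan_Elimination"
begin

hide_const (open) Finite_Cartesian_Product.mat Finite_Cartesian_Product.vec

definition knot_mult :: "nat \<Rightarrow> nat \<Rightarrow> (nat \<Rightarrow> real) \<Rightarrow> real \<Rightarrow> nat" where
  "knot_mult p n \<xi> z = card {i \<in> {1..n + p + 1}. \<xi> i = z}"

text \<open>A \<open>(p+1)\<close>-open knot sequence \<open>\<xi> 1 \<le> \<dots> \<le> \<xi> (n+p+1)\<close> on \<open>[a,b]\<close>;
  values of \<open>\<xi>\<close> outside \<open>{1..n+p+1}\<close> are irrelevant.\<close>

definition open_knots :: "nat \<Rightarrow> nat \<Rightarrow> real \<Rightarrow> real \<Rightarrow> (nat \<Rightarrow> real) \<Rightarrow> bool" where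
  "open_knots p n a b \<xi> \<longleftrightarrow>
     p < n \<and> mono_on {1..n + p + 1} \<xi> \<and>
     (\<exists>(r :: nat) (\<zeta> :: nat \<Rightarrow> real). strict_mono_on {1..r} \<zeta> \<and> \<zeta> ` {1..r} = \<xi> ` {1..n + p + 1} \<and>
        \<zeta> 1 = a \<and> \<zeta> r = b \<and>
        knot_mult p n \<xi> (\<zeta> 1) = p + 1 \<and> knot_mult p n \<xi> (\<zeta> r) = p + 1 \<and>
        (\<forall>j\<in>{1<..<r}. 1 \<le> knot_mult p n \<xi> (\<zeta> j) \<and> knot_mult p n \<xi> (\<zeta> j) \<le> p + 1))"

text \<open>The convention \<open>0/0 := 0\<close> is provided by division by zero in HOL: whenever a
  denominator below vanishes, so does the B-spline it multiplies.\<close>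

fun bspline :: "(nat \<Rightarrow> real) \<Rightarrow> nat \<Rightarrow> nat \<Rightarrow> real \<Rightarrow> real" where
  "bspline \<xi> 0 i x = (if \<xi> i \<le> x \<and> x < \<xi> (i + 1) then 1 else 0)"
| "bspline \<xi> (Suc p) i x =
     (x - \<xi> i) / (\<xi> (i + Suc p) - \<xi> i) * bspline \<xi> p i x +
     (\<xi> (i + Suc p + 1) - x) / (\<xi> (i + Suc p + 1) - \<xi> (i + 1)) * bspline \<xi> p (i + 1) x"

text \<open>Vectors and matrices are indexed from \<open>0\<close>: entry \<open>j\<close> of \<open>bspline_vec\<close> is the
  \<open>(j+1)\<close>-st component of \<open>(1, B\<^sub>2, \<dots>, B\<^sub>n)\<close>.\<close>

definition bspline_vec :: "nat \<Rightarrow> nat \<Rightarrow> (nat \<Rightarrow> real) \<Rightarrow> real \<Rightarrow> real Matrix.vec" where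
  "bspline_vec p n \<xi> x = Matrix.vec n (\<lambda>j. if j = 0 then 1 else bspline \<xi> p (j + 1) x)"

definition gram_mat ::
  "'w measure \<Rightarrow> ('w \<Rightarrow> real) \<Rightarrow> nat \<Rightarrow> nat \<Rightarrow> (nat \<Rightarrow> real) \<Rightarrow> real Matrix.mat" where
  "gram_mat M Z p n \<xi> = Matrix.mat n n (\<lambda>(i, j).
     prob_space.expectation M
       (\<lambda>\<omega>. vec_index (bspline_vec p n \<xi> (Z \<omega>)) i * vec_index (bspline_vec p n \<xi> (Z \<omega>)) j))"

definition is_cholesky :: "real Matrix.mat \<Rightarrow> real Matrix.mat \<Rightarrow> bool" where
  "is_cholesky G Q \<longleftrightarrow>
     Q \<in> carrier_mat (dim_row G) (dim_row G) \<and>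
     (\<forall>i < dim_row G. \<forall>j < dim_row G. i < j \<longrightarrow> Q $$ (i, j) = 0) \<and>
     (\<forall>i < dim_row G. Q $$ (i, i) > 0) \<and>
     G = Q * transpose_mat Q"

text \<open>The Cholesky factor of a symmetric positive-definite matrix exists and is unique.\<close>

definition cholesky :: "real Matrix.mat \<Rightarrow> real Matrix.mat" where
  "cholesky G = (THE Q. is_cholesky G Q)"

text \<open>\<open>ortho_bspline M Z p n \<xi> i\<close>, for \<open>i \<in> {1..n}\<close>, is the \<open>i\<close>-th component (counted from
  \<open>1\<close>) of \<open>Q\<^sup>-\<^sup>1 P\<close>, orthonormal with respect to the distribution of \<open>Z\<close>.\<close>

definition ortho_bspline ::
  "'w measure \<Rightarrow> ('w \<Rightarrow> real) \<Rightarrow> nat \<Rightarrow> nat \<Rightarrow> (nat \<Rightarrow> real) \<Rightarrow> nat \<Rightarrow> real \<Rightarrow> real" where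
  "ortho_bspline M Z p n \<xi> i x =
     vec_index (the (mat_inverse (cholesky (gram_mat M Z p n \<xi>))) *\<^sub>v bspline_vec p n \<xi> x) (i - 1)"

definition multi_indices :: "(nat \<Rightarrow> nat) \<Rightarrow> nat set \<Rightarrow> (nat \<Rightarrow> nat) set" where
  "multi_indices n u = (\<Pi>\<^sub>E k\<in>u. {2..n k})"

text \<open>\<open>sdd_basis\<close> takes the full vector \<open>x\<close> but depends only on the coordinates in \<open>u\<close>.\<close>

definition sdd_basis ::
  "'w measure \<Rightarrow> ('w \<Rightarrow> nat \<Rightarrow> real) \<Rightarrow> (nat \<Rightarrow> nat) \<Rightarrow> (nat \<Rightarrow> nat) \<Rightarrow> (nat \<Rightarrow> nat \<Rightarrow> real) \<Rightarrow>
   nat set \<Rightarrow> (nat \<Rightarrow> nat) \<Rightarrow> (nat \<Rightarrow> real) \<Rightarrow> real" where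
  "sdd_basis M X p n \<Xi> u i x =
     (\<Prod>k\<in>u. ortho_bspline M (\<lambda>\<omega>. X \<omega> k) (p k) (n k) (\<Xi> k) (i k) (x k))"

definition sdd_const ::
  "'w measure \<Rightarrow> ('w \<Rightarrow> nat \<Rightarrow> real) \<Rightarrow> ((nat \<Rightarrow> real) \<Rightarrow> real) \<Rightarrow> real" where
  "sdd_const M X y = prob_space.expectation M (\<lambda>\<omega>. y (X \<omega>))"

definition sdd_coeff ::
  "'w measure \<Rightarrow> ('w \<Rightarrow> nat \<Rightarrow> real) \<Rightarrow> (nat \<Rightarrow> nat) \<Rightarrow> (nat \<Rightarrow> nat) \<Rightarrow> (nat \<Rightarrow> nat \<Rightarrow> real) \<Rightarrow>
   ((nat \<Rightarrow> real) \<Rightarrow> real) \<Rightarrow> nat set \<Rightarrow> (nat \<Rightarrow> nat) \<Rightarrow> real" where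
  "sdd_coeff M X p n \<Xi> y u i =
     prob_space.expectation M (\<lambda>\<omega>. y (X \<omega>) * sdd_basis M X p n \<Xi> u i (X \<omega>))"

definition sdd_subsets :: "nat \<Rightarrow> nat \<Rightarrow> nat set set" where
  "sdd_subsets N S = {u. u \<noteq> {} \<and> u \<subseteq> {1..N} \<and> 1 \<le> card u \<and> card u \<le> S}"

definition sdd_approx ::
  "'w measure \<Rightarrow> nat \<Rightarrow> ('w \<Rightarrow> nat \<Rightarrow> real) \<Rightarrow> (nat \<Rightarrow> nat) \<Rightarrow> (nat \<Rightarrow> nat) \<Rightarrow>
   (nat \<Rightarrow> nat \<Rightarrow> real) \<Rightarrow> nat \<Rightarrow> ((nat \<Rightarrow> real) \<Rightarrow> real) \<Rightarrow> (nat \<Rightarrow> real) \<Rightarrow> real" where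
  "sdd_approx M N X p n \<Xi> S y x =
     sdd_const M X y +
     (\<Sum>u\<in>sdd_subsets N S. \<Sum>i\<in>multi_indices n u.
        sdd_coeff M X p n \<Xi> y u i * sdd_basis M X p n \<Xi> u i x)"

end

theory Submission
  imports Defs "Jordan_Normal_Form.Determinant"
begin

text \<open>
The SDD approximation is, apart from the constant \<open>\<E>[y(X)]\<close>, the orthogonal projection of
\<open>y(X)\<close> onto the span of finitely many tensor products \<open>\<Psi>\<^sup>u\<^sub>i(X)\<close>. Once these are known to be
orthonormal in \<open>L\<^sup>2\<close> and to have mean zero, the mean and variance can be read off, and the
variance bound is Bessel's inequality (\<open>orthonormal_projection_moments\<close>). By independence the
expectation of a product of two tensor products factors over the coordinates
(\<open>tensor_product_orthonormal\<close>), so everything reduces to one variable: the functions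
\<open>\<psi>\<^sub>1, \<dots>, \<psi>\<^sub>n\<close> are orthonormal, and \<open>\<psi>\<^sub>2, \<dots>, \<psi>\<^sub>n\<close> have mean zero because they are
orthogonal to the constant function, which is the first component of \<open>P\<close>
(\<open>ortho_bspline_orthonormal\<close>).

In one variable the functions are \<open>\<psi> = Q\<^sup>-\<^sup>1 P\<close>, where \<open>Q\<close> is the Cholesky factor of the Gram
matrix \<open>G\<close>, hence \<open>\<E>[\<psi> \<psi>\<^sup>T] = Q\<^sup>-\<^sup>1 G Q\<^sup>-\<^sup>T = 1\<close>. This requires that the factor exists and is
unique (\<open>cholesky_whitening\<close>), that is, that \<open>G\<close> is positive definite: no nontrivial
combination of \<open>1, B\<^sub>2, \<dots>, B\<^sub>n\<close> vanishes almost surely at \<open>Z\<close>. As the density is continuous and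
nonzero on a dense subset of \<open>[a,b]\<close>, and the combination is continuous between consecutive
knots, vanishing almost surely means vanishing identically on every open knot interval
(\<open>bspline_comb_L2_definite\<close>). What remains is the linear independence of B-splines.

On a nonempty knot interval \<open>(\<xi>\<^sub>m, \<xi>\<^sub>m\<^sub>+\<^sub>1)\<close> only the \<open>p + 1\<close> B-splines with index in
\<open>{m - p..m}\<close> are active, and already these are independent there
(\<open>local_spline_independent\<close>). The proof is by induction on \<open>p\<close>. The derivative of a combination is
a combination of degree \<open>p - 1\<close> with divided differences of the coefficients as its coefficients;
so if the combination vanishes, all its coefficients are equal, and the partition of unity shows
that their common value is \<open>0\<close>. Since no knot has multiplicity above \<open>p + 1\<close>, every \<open>B\<^sub>i\<close> is
active on some nonempty interval, and this gives independence on \<open>[a,b]\<close>. The constant function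
may replace \<open>B\<^sub>1\<close> because \<open>1 = B\<^sub>1 + \<dots> + B\<^sub>n\<close>.
\<close>

section \<open>Local structure of B-splines\<close>

text \<open>
A B-spline only sees the knots of its own support. A knot sequence may therefore be altered outside
the relevant range, in particular made monotone on all of \<open>nat\<close>.
\<close>

lemma bspline_cong:
  assumes "\<And>j. i \<le> j \<Longrightarrow> j \<le> i + p + 1 \<Longrightarrow> \<xi> j = \<eta> j"
  shows "bspline \<xi> p i x = bspline \<eta> p i x"
  using assms
proof (induction p arbitrary: i)
  case (Suc p)
  have "bspline \<xi> p i x = bspline \<eta> p i x" "bspline \<xi> p (i + 1) x = bspline \<eta> p (i + 1) x"
    using Suc.prems by (auto intro!: Suc.IH)
  moreover have "\<xi> i = \<eta> i" "\<xi> (i + Suc p) = \<eta> (i + Suc p)"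
      "\<xi> (i + Suc p + 1) = \<eta> (i + Suc p + 1)" "\<xi> (i + 1) = \<eta> (i + 1)"
    by (rule Suc.prems; simp)+
  ultimately show ?case by simp
qed simp

lemma bspline_eq_0_below:
  assumes "mono \<xi>" "x < \<xi> i"
  shows "bspline \<xi> p i x = 0"
  using assms(2)
proof (induction p arbitrary: i)
  case (Suc p)
  have "\<xi> i \<le> \<xi> (i + 1)" using assms(1) by (simp add: monoD)
  then show ?case using Suc.IH[of i] Suc.IH[of "i + 1"] Suc.prems by simp
qed simp

lemma bspline_eq_0_above:
  assumes "mono \<xi>" "\<xi> (i + p + 1) \<le> x"
  shows "bspline \<xi> p i x = 0"
  using assms(2)
proof (induction p arbitrary: i)
  case (Suc p)
  have "\<xi> (i + p + 1) \<le> \<xi> (i + Suc p + 1)" by (rule monoD[OF assms(1)]) simp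
  then have "bspline \<xi> p i x = 0" using Suc.prems by (intro Suc.IH) linarith
  moreover have "bspline \<xi> p (i + 1) x = 0" using Suc.prems by (intro Suc.IH) simp
  ultimately show ?case by simp
qed simp

text \<open>
The recursion multiplies by affine functions with constant coefficients, which are bounded on an
interval; a vanishing denominator makes the corresponding term zero.
\<close>

lemma bspline_bounded_on_interval:
  "\<exists>C. \<forall>x\<in>{a..b}. \<bar>bspline \<xi> p i x\<bar> \<le> C"
proof (induction p arbitrary: i)
  case 0
  show ?case by (rule exI[of _ 1]) auto
next
  case (Suc p)
  obtain C D where C: "\<And>x. x \<in> {a..b} \<Longrightarrow> \<bar>bspline \<xi> p i x\<bar> \<le> C"
    and D: "\<And>x. x \<in> {a..b} \<Longrightarrow> \<bar>bspline \<xi> p (i + 1) x\<bar> \<le> D"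
    using Suc.IH[of i] Suc.IH[of "i + 1"] by blast
  define d e where "d = \<bar>\<xi> (i + Suc p) - \<xi> i\<bar>" and "e = \<bar>\<xi> (i + Suc p + 1) - \<xi> (i + 1)\<bar>"
  have nn: "d \<ge> 0" "e \<ge> 0" by (auto simp: d_def e_def)
  have "\<bar>bspline \<xi> (Suc p) i x\<bar> \<le>
      (\<bar>a\<bar> + \<bar>b\<bar> + \<bar>\<xi> i\<bar>) / d * C + (\<bar>a\<bar> + \<bar>b\<bar> + \<bar>\<xi> (i + Suc p + 1)\<bar>) / e * D"
    if x: "x \<in> {a..b}" for x
  proof -
    have 1: "\<bar>x - \<xi> i\<bar> / d * \<bar>bspline \<xi> p i x\<bar> \<le> (\<bar>a\<bar> + \<bar>b\<bar> + \<bar>\<xi> i\<bar>) / d * C"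
      using x nn C[OF x] by (intro mult_mono divide_right_mono) (auto intro!: divide_nonneg_nonneg)
    have 2: "\<bar>\<xi> (i + Suc p + 1) - x\<bar> / e * \<bar>bspline \<xi> p (i + 1) x\<bar>
        \<le> (\<bar>a\<bar> + \<bar>b\<bar> + \<bar>\<xi> (i + Suc p + 1)\<bar>) / e * D"
      using x nn D[OF x] by (intro mult_mono divide_right_mono) (auto intro!: divide_nonneg_nonneg)
    have "\<bar>bspline \<xi> (Suc p) i x\<bar> \<le> \<bar>x - \<xi> i\<bar> / d * \<bar>bspline \<xi> p i x\<bar>
        + \<bar>\<xi> (i + Suc p + 1) - x\<bar> / e * \<bar>bspline \<xi> p (i + 1) x\<bar>"
      unfolding bspline.simps d_def e_def
      by (rule order_trans[OF abs_triangle_ineq]) (simp add: abs_mult)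
    then show ?thesis using 1 2 by linarith
  qed
  then show ?case by blast
qed

lemma bspline_measurable [measurable]: "bspline \<xi> p i \<in> borel_measurable borel"
proof (induction p arbitrary: i)
  case 0
  have "bspline \<xi> 0 i = indicat_real {\<xi> i..<\<xi> (i + 1)}"
    by (auto simp: indicator_def fun_eq_iff)
  then show ?case by simp
next
  case (Suc p)
  note [measurable] = Suc.IH
  show ?case by simp
qed

text \<open>
The combination of the B-splines with index in \<open>{l..l + p}\<close>, the only ones that can be nonzero
on the interval between \<open>\<xi> (l + p)\<close> and \<open>\<xi> (l + p + 1)\<close>. Indexing the window by its left
end \<open>l\<close> avoids subtraction: lowering the degree by one on the same interval replaces \<open>l\<close> by
\<open>l + 1\<close>.
\<close>

definition local_spline :: "(nat \<Rightarrow> real) \<Rightarrow> nat \<Rightarrow> nat \<Rightarrow> (nat \<Rightarrow> real) \<Rightarrow> real \<Rightarrow> real" where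
  "local_spline \<xi> p l c x = (\<Sum>j\<le>p. c j * bspline \<xi> p (l + j) x)"

lemma local_spline_cong:
  "(\<And>j. j \<le> p \<Longrightarrow> c j = d j) \<Longrightarrow> local_spline \<xi> p l c x = local_spline \<xi> p l d x"
  by (simp add: local_spline_def)

text \<open>
One step of de Boor's algorithm: the coefficients, depending on \<open>x\<close>, that represent a spline of
degree \<open>p + 1\<close> by B-splines of degree \<open>p\<close>.
\<close>

definition de_boor :: "(nat \<Rightarrow> real) \<Rightarrow> nat \<Rightarrow> nat \<Rightarrow> (nat \<Rightarrow> real) \<Rightarrow> real \<Rightarrow> nat \<Rightarrow> real" where
  "de_boor \<xi> p l c x j =
     (c (j + 1) * (x - \<xi> (l + 1 + j)) + c j * (\<xi> (l + 1 + j + Suc p) - x))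
       / (\<xi> (l + 1 + j + Suc p) - \<xi> (l + 1 + j))"

lemma local_spline_Suc:
  assumes "mono \<xi>" "\<xi> (l + Suc p) < x" "x < \<xi> (l + Suc p + 1)"
  shows "local_spline \<xi> (Suc p) l c x = local_spline \<xi> p (l + 1) (de_boor \<xi> p l c x) x"
proof -
  let ?w = "\<lambda>i. (x - \<xi> i) / (\<xi> (i + Suc p) - \<xi> i) * bspline \<xi> p i x"
  let ?v = "\<lambda>i. (\<xi> (i + Suc p) - x) / (\<xi> (i + Suc p) - \<xi> i) * bspline \<xi> p i x"
  \<comment> \<open>Expanding the recursion produces two B-splines at the ends of the window that are inactive here.\<close>
  have "bspline \<xi> p l x = 0" using assms(2) by (intro bspline_eq_0_above[OF assms(1)]) simp
  moreover have "bspline \<xi> p (l + p + 2) x = 0"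
    using assms(3) by (intro bspline_eq_0_below[OF assms(1)]) simp
  ultimately have z: "bspline \<xi> p l x = 0" "bspline \<xi> p (l + p + 2) x = 0" .
  have "local_spline \<xi> (Suc p) l c x
      = (\<Sum>j\<le>Suc p. c j * ?w (l + j)) + (\<Sum>j\<le>Suc p. c j * ?v (l + j + 1))"
    unfolding local_spline_def sum.distrib[symmetric] by (simp add: algebra_simps)
  also have "(\<Sum>j\<le>Suc p. c j * ?w (l + j)) = (\<Sum>j\<le>p. c (j + 1) * ?w (l + 1 + j))"
    unfolding sum.atMost_Suc_shift[of _ p] using z by simp
  also have "(\<Sum>j\<le>Suc p. c j * ?v (l + j + 1)) = (\<Sum>j\<le>p. c j * ?v (l + 1 + j))"
    using z by (simp add: algebra_simps)
  also have "(\<Sum>j\<le>p. c (j + 1) * ?w (l + 1 + j)) + \<dots>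
      = local_spline \<xi> p (l + 1) (de_boor \<xi> p l c x) x"
    unfolding local_spline_def de_boor_def sum.distrib[symmetric]
    by (intro sum.cong refl) (simp only: add_divide_distrib ring_distribs times_divide_eq_right times_divide_eq_left mult.assoc)
  finally show ?thesis .
qed

text \<open>
Every denominator that occurs between \<open>\<xi> m\<close> and \<open>\<xi> (m + 1)\<close> straddles this nonempty interval; the
convention for \<open>0/0\<close> is never invoked locally.
\<close>

lemma local_knots_less:
  fixes \<xi> :: "nat \<Rightarrow> real"
  assumes "mono \<xi>" "\<xi> m < \<xi> (m + 1)" "i \<le> m" "m < k"
  shows "\<xi> i < \<xi> k"
proof -
  have "\<xi> i \<le> \<xi> m" "\<xi> (m + 1) \<le> \<xi> k" using assms(3,4) by (auto intro!: monoD[OF assms(1)])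
  then show ?thesis using assms(2) by simp
qed

text \<open>
Partition of unity, in local form: a de Boor step turns equal coefficients into the same equal
coefficients, being a convex combination of neighbours.
\<close>

lemma local_spline_const:
  assumes "mono \<xi>" "\<xi> (l + p) < x" "x < \<xi> (l + p + 1)"
  shows "local_spline \<xi> p l (\<lambda>_. r) x = r"
  using assms(2,3)
proof (induction p arbitrary: l)
  case 0
  then show ?case by (simp add: local_spline_def)
next
  case (Suc p)
  have lt: "\<xi> (l + Suc p) < \<xi> (l + Suc p + 1)" using Suc.prems by simp
  have "local_spline \<xi> (Suc p) l (\<lambda>_. r) x
      = local_spline \<xi> p (l + 1) (de_boor \<xi> p l (\<lambda>_. r) x) x"
    by (rule local_spline_Suc[OF assms(1) Suc.prems])
  also have "\<dots> = local_spline \<xi> p (l + 1) (\<lambda>_. r) x"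
  proof (rule local_spline_cong)
    fix j assume "j \<le> p"
    then have "\<xi> (l + 1 + j) < \<xi> (l + 1 + j + Suc p)"
      using local_knots_less[OF assms(1) lt] by simp
    then show "de_boor \<xi> p l (\<lambda>_. r) x j = r"
      by (simp add: de_boor_def divide_simps) (simp add: algebra_simps)
  qed
  also have "\<dots> = r" using Suc.prems by (intro Suc.IH) (simp_all add: algebra_simps)
  finally show ?case .
qed

text \<open>
Up to the factor \<open>p\<close>, the coefficients of the derivative of a spline of degree \<open>p\<close>.
\<close>

definition diff_coeff :: "(nat \<Rightarrow> real) \<Rightarrow> nat \<Rightarrow> nat \<Rightarrow> (nat \<Rightarrow> real) \<Rightarrow> nat \<Rightarrow> real" where
  "diff_coeff \<xi> p l c j =
     (c (j + 1) - c j) / (\<xi> (l + 1 + j + p) - \<xi> (l + 1 + j))"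

text \<open>
The heart of the derivative formula: differencing the coefficients after a de Boor step is the same
as performing a de Boor step on the differenced coefficients. Both neighbouring coefficients are
affine in \<open>x\<close> and pass through the common value \<open>c (j + 1)\<close>.
\<close>

lemma diff_coeff_de_boor:
  assumes "\<xi> (l + 1 + j) < \<xi> (l + 1 + j + Suc p)" "\<xi> (l + 2 + j) < \<xi> (l + 2 + j + Suc p)"
    and "\<xi> (l + 2 + j) < \<xi> (l + 2 + j + p)"
  shows "diff_coeff \<xi> p (l + 1) (de_boor \<xi> p l c x) j
       = (diff_coeff \<xi> (Suc p) l c (j + 1) * (x - \<xi> (l + 2 + j))
          + diff_coeff \<xi> (Suc p) l c j * (\<xi> (l + 2 + j + p) - x))
         / (\<xi> (l + 2 + j + p) - \<xi> (l + 2 + j))"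
proof -
  have 1: "de_boor \<xi> p l c x (j + 1)
      = c (j + 1) + diff_coeff \<xi> (Suc p) l c (j + 1) * (x - \<xi> (l + 2 + j))"
    using assms(2) unfolding de_boor_def diff_coeff_def
    by (simp add: field_simps)
  have 2: "de_boor \<xi> p l c x j
      = c (j + 1) - diff_coeff \<xi> (Suc p) l c j * (\<xi> (l + 2 + j + p) - x)"
    using assms(1) unfolding de_boor_def diff_coeff_def
    by (simp add: field_simps)
  show ?thesis unfolding diff_coeff_def[of \<xi> p "l + 1"] 1 2 by simp
qed

text \<open>
Induction on the degree through the de Boor step
\<open>local_spline \<xi> (Suc p) l c x = local_spline \<xi> p (l + 1) (de_boor \<xi> p l c x) x\<close>. By the product rule
the derivative consists of one part from the coefficients, whose slopes are \<open>diff_coeff\<close>, and one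
part from the B-splines of degree \<open>p\<close>. By \<open>diff_coeff_de_boor\<close> the second part is \<open>p\<close> times the
first, which yields the factor \<open>Suc p\<close>.
\<close>

lemma local_spline_deriv:
  assumes "mono \<xi>" "\<xi> (l + p) < x" "x < \<xi> (l + p + 1)"
  shows "(local_spline \<xi> p l c has_real_derivative
            real p * local_spline \<xi> (p - 1) (l + 1) (diff_coeff \<xi> p l c) x) (at x)"
  using assms(2,3)
proof (induction p arbitrary: l c)
  case 0
  have "((\<lambda>_. c 0) has_real_derivative 0) (at x)" by simp
  then have "(local_spline \<xi> 0 l c has_real_derivative 0) (at x)"
    by (rule has_field_derivative_transform_within_open[where S = "{\<xi> l<..<\<xi> (l + 1)}"])
      (use 0 in \<open>auto simp: local_spline_def\<close>)
  then show ?case by simp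
next
  case (Suc p)
  let ?I = "{\<xi> (l + Suc p)<..<\<xi> (l + Suc p + 1)}"
  have lt: "\<xi> (l + Suc p) < \<xi> (l + Suc p + 1)" using Suc.prems by simp
  note kn = local_knots_less[OF assms(1) lt]
  have IH: "(local_spline \<xi> p (l + 1) e has_real_derivative
      real p * local_spline \<xi> (p - 1) (l + 2) (diff_coeff \<xi> p (l + 1) e) x) (at x)" for e
    using Suc.IH[of "l + 1" e] Suc.prems by simp
  \<comment> \<open>The derivatives of single B-splines, obtained from the induction hypothesis with unit coefficients; they allow the coefficients to be varied together with the argument.\<close>
  define D where "D j = real p * local_spline \<xi> (p - 1) (l + 2)
      (diff_coeff \<xi> p (l + 1) (\<lambda>k. if k = j then 1 else 0)) x" for j
  have D: "(bspline \<xi> p (l + 1 + j) has_real_derivative D j) (at x)" if "j \<le> p" for j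
  proof -
    have "local_spline \<xi> p (l + 1) (\<lambda>k. if k = j then 1 else 0) = bspline \<xi> p (l + 1 + j)"
      using that by (auto simp: local_spline_def fun_eq_iff if_distrib if_distribR cong: if_cong)
    then show ?thesis using IH[of "\<lambda>k. if k = j then 1 else 0"] by (simp add: D_def)
  qed
  have sumD: "(\<Sum>j\<le>p. e j * D j)
      = real p * local_spline \<xi> (p - 1) (l + 2) (diff_coeff \<xi> p (l + 1) e) x" for e
  proof (rule DERIV_unique)
    show "(local_spline \<xi> p (l + 1) e has_real_derivative (\<Sum>j\<le>p. e j * D j)) (at x)"
      unfolding local_spline_def[abs_def] by (intro DERIV_sum DERIV_cmult D) simp
  qed (rule IH)
  let ?d = "de_boor \<xi> p l c x" and ?s = "diff_coeff \<xi> (Suc p) l c"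
  have d: "((\<lambda>t. de_boor \<xi> p l c t j) has_real_derivative ?s j) (at x)" for j
    unfolding de_boor_def diff_coeff_def
    by (intro DERIV_cdivide) (auto intro!: derivative_eq_intros)
  have "((\<lambda>t. local_spline \<xi> p (l + 1) (de_boor \<xi> p l c t) t) has_real_derivative
      (\<Sum>j\<le>p. ?s j * bspline \<xi> p (l + 1 + j) x + ?d j * D j)) (at x)"
    unfolding local_spline_def
    by (rule DERIV_sum, rule DERIV_cong[OF DERIV_mult[OF d D]]) simp_all
  then have "(local_spline \<xi> (Suc p) l c has_real_derivative
      (\<Sum>j\<le>p. ?s j * bspline \<xi> p (l + 1 + j) x + ?d j * D j)) (at x)"
    by (rule has_field_derivative_transform_within_open[where S = ?I])
      (use Suc.prems in \<open>auto simp: local_spline_Suc[OF assms(1)]\<close>)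
  also have "(\<Sum>j\<le>p. ?s j * bspline \<xi> p (l + 1 + j) x + ?d j * D j)
      = local_spline \<xi> p (l + 1) ?s x
        + real p * local_spline \<xi> (p - 1) (l + 2) (diff_coeff \<xi> p (l + 1) ?d) x"
    unfolding sumD[symmetric] unfolding local_spline_def sum.distrib by simp
  also have "real p * local_spline \<xi> (p - 1) (l + 2) (diff_coeff \<xi> p (l + 1) ?d) x
      = real p * local_spline \<xi> p (l + 1) ?s x"
  proof (cases p)
    case (Suc q)
    have "local_spline \<xi> p (l + 1) ?s x = local_spline \<xi> q (l + 2) (de_boor \<xi> q (l + 1) ?s x) x"
      using local_spline_Suc[of \<xi> "l + 1" q x ?s] assms(1) Suc Suc.prems by simp
    also have "\<dots> = local_spline \<xi> q (l + 2) (diff_coeff \<xi> p (l + 1) ?d) x"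
    proof (rule local_spline_cong)
      fix j assume "j \<le> q"
      then show "de_boor \<xi> q (l + 1) ?s x j = diff_coeff \<xi> p (l + 1) ?d j"
        using Suc kn[of "l + 1 + j" "l + 1 + j + Suc p"] kn[of "l + 2 + j" "l + 2 + j + Suc p"]
          kn[of "l + 2 + j" "l + 2 + j + p"]
        by (subst diff_coeff_de_boor) (simp_all add: de_boor_def)
    qed
    finally show ?thesis using Suc by simp
  qed simp
  also have "local_spline \<xi> p (l + 1) ?s x + real p * local_spline \<xi> p (l + 1) ?s x
      = real (Suc p) * local_spline \<xi> p (l + 1) ?s x"
    by (simp add: algebra_simps)
  finally show ?case by simp
qed

lemma local_spline_independent:
  assumes "mono \<xi>" "\<xi> (l + p) < \<xi> (l + p + 1)"
    and "\<And>x. \<xi> (l + p) < x \<Longrightarrow> x < \<xi> (l + p + 1) \<Longrightarrow> local_spline \<xi> p l c x = 0"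
    and "j \<le> p"
  shows "c j = 0"
  using assms(2-)
proof (induction p arbitrary: l c j)
  case 0
  obtain x where "\<xi> l < x" "x < \<xi> (l + 1)" using dense[OF 0(1)] by auto
  then show ?case using 0(2)[of x] 0(3) by (simp add: local_spline_def)
next
  case (Suc p)
  note kn = local_knots_less[OF assms(1) Suc.prems(1)]
  have z: "local_spline \<xi> p (l + 1) (diff_coeff \<xi> (Suc p) l c) x = 0"
    if x: "\<xi> (l + Suc p) < x" "x < \<xi> (l + Suc p + 1)" for x
  proof -
    have "((\<lambda>_. 0) has_real_derivative 0) (at x)" by simp
    then have "(local_spline \<xi> (Suc p) l c has_real_derivative 0) (at x)"
      by (rule has_field_derivative_transform_within_open
          [where S = "{\<xi> (l + Suc p)<..<\<xi> (l + Suc p + 1)}"])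
        (use x Suc.prems(2) in auto)
    from DERIV_unique[OF this local_spline_deriv[OF assms(1) x]] show ?thesis by simp
  qed
  have eq: "c (i + 1) = c i" if "i \<le> p" for i
  proof -
    have "diff_coeff \<xi> (Suc p) l c i = 0"
    proof (rule Suc.IH[of "l + 1"])
      show "\<xi> (l + 1 + p) < \<xi> (l + 1 + p + 1)" using Suc.prems(1) by simp
      show "local_spline \<xi> p (l + 1) (diff_coeff \<xi> (Suc p) l c) x = 0"
        if "\<xi> (l + 1 + p) < x" "x < \<xi> (l + 1 + p + 1)" for x
        using that by (intro z) simp_all
    qed (fact that)
    then show ?thesis
      using kn[of "l + 1 + i" "l + 1 + i + Suc p"] that by (simp add: diff_coeff_def)
  qed
  have const: "c i = c 0" if "i \<le> Suc p" for i
    using that by (induction i) (use eq in auto)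
  obtain x where x: "\<xi> (l + Suc p) < x" "x < \<xi> (l + Suc p + 1)"
    using dense[OF Suc.prems(1)] by auto
  have "0 = local_spline \<xi> (Suc p) l c x" using Suc.prems(2)[OF x] by simp
  also have "\<dots> = local_spline \<xi> (Suc p) l (\<lambda>_. c 0) x"
    by (intro local_spline_cong const)
  also have "\<dots> = c 0" by (rule local_spline_const[OF assms(1) x])
  finally show ?case using const[OF Suc.prems(3)] by simp
qed

section \<open>Independence of B-splines on an open knot sequence\<close>

text \<open>
A collapse of \<open>\<xi> i, \<dots>, \<xi> (i + p + 1)\<close> would create a knot of multiplicity \<open>p + 2\<close>.
\<close>

lemma open_knots_less:
  assumes "open_knots p n a b \<xi>" "i \<in> {1..n}"
  shows "\<xi> i < \<xi> (i + p + 1)"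
proof (rule ccontr)
  assume "\<not> ?thesis"
  then have ge: "\<xi> (i + p + 1) \<le> \<xi> i" by simp
  have mono: "mono_on {1..n + p + 1} \<xi>" using assms(1) unfolding open_knots_def by blast
  obtain r :: nat and \<zeta> :: "nat \<Rightarrow> real" where \<zeta>: "\<zeta> ` {1..r} = \<xi> ` {1..n + p + 1}"
    and mult: "knot_mult p n \<xi> (\<zeta> 1) = p + 1" "knot_mult p n \<xi> (\<zeta> r) = p + 1"
      "\<forall>j\<in>{1<..<r}. 1 \<le> knot_mult p n \<xi> (\<zeta> j) \<and> knot_mult p n \<xi> (\<zeta> j) \<le> p + 1"
    using assms(1) unfolding open_knots_def by (elim conjE exE) (rule that; assumption)
  have "\<xi> i \<in> \<xi> ` {1..n + p + 1}" using assms(2) by auto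
  then obtain j where j: "j \<in> {1..r}" "\<xi> i = \<zeta> j" using \<zeta> by blast
  then have "knot_mult p n \<xi> (\<xi> i) \<le> p + 1"
    using mult by (cases "j = 1 \<or> j = r") auto
  moreover have "{i..i + p + 1} \<subseteq> {k \<in> {1..n + p + 1}. \<xi> k = \<xi> i}"
  proof
    fix k assume k: "k \<in> {i..i + p + 1}"
    then have "\<xi> i \<le> \<xi> k" "\<xi> k \<le> \<xi> (i + p + 1)"
      using assms(2) by (auto intro!: mono_onD[OF mono])
    then show "k \<in> {k \<in> {1..n + p + 1}. \<xi> k = \<xi> i}" using ge k assms(2) by auto
  qed
  then have "card {i..i + p + 1} \<le> knot_mult p n \<xi> (\<xi> i)"
    unfolding knot_mult_def by (intro card_mono) auto
  ultimately show False by simp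
qed

lemma open_knots_left:
  assumes "open_knots p n a b \<xi>" "k \<in> {1..p + 1}"
  shows "\<xi> k = a"
proof (rule antisym)
  have mono: "mono_on {1..n + p + 1} \<xi>" using assms(1) unfolding open_knots_def by blast
  obtain r :: nat and \<zeta> :: "nat \<Rightarrow> real" where \<zeta>: "strict_mono_on {1..r} \<zeta>" "\<zeta> ` {1..r} = \<xi> ` {1..n + p + 1}" "\<zeta> 1 = a"
    and mult: "knot_mult p n \<xi> (\<zeta> 1) = p + 1"
    using assms(1) unfolding open_knots_def by (elim conjE exE) (rule that; assumption)
  have k: "k \<in> {1..n + p + 1}" using assms(2) by auto
  then obtain j where j: "j \<in> {1..r}" "\<xi> k = \<zeta> j" using \<zeta>(2) by blast
  then show "a \<le> \<xi> k"
    using strict_mono_on_leD[OF \<zeta>(1), of 1 j] \<zeta>(3) by auto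
  show "\<xi> k \<le> a"
  proof (rule ccontr)
    assume "\<not> \<xi> k \<le> a"
    then have "{i \<in> {1..n + p + 1}. \<xi> i = a} \<subseteq> {1..<k}"
      using mono_onD[OF mono k] by (force simp: not_le)
    then have "knot_mult p n \<xi> a \<le> card {1..<k}"
      unfolding knot_mult_def by (intro card_mono) auto
    then show False using mult \<zeta>(3) assms(2) by auto
  qed
qed

lemma open_knots_right:
  assumes "open_knots p n a b \<xi>" "k \<in> {n + 1..n + p + 1}"
  shows "\<xi> k = b"
proof (rule antisym)
  have mono: "mono_on {1..n + p + 1} \<xi>" using assms(1) unfolding open_knots_def by blast
  obtain r :: nat and \<zeta> :: "nat \<Rightarrow> real" where \<zeta>: "strict_mono_on {1..r} \<zeta>" "\<zeta> ` {1..r} = \<xi> ` {1..n + p + 1}" "\<zeta> r = b"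
    and mult: "knot_mult p n \<xi> (\<zeta> r) = p + 1"
    using assms(1) unfolding open_knots_def by (elim conjE exE) (rule that; assumption)
  have k: "k \<in> {1..n + p + 1}" using assms(2) by auto
  then obtain j where j: "j \<in> {1..r}" "\<xi> k = \<zeta> j" using \<zeta>(2) by blast
  then show "\<xi> k \<le> b"
    using strict_mono_on_leD[OF \<zeta>(1), of j r] \<zeta>(3) by auto
  show "b \<le> \<xi> k"
  proof (rule ccontr)
    assume "\<not> b \<le> \<xi> k"
    then have "{i \<in> {1..n + p + 1}. \<xi> i = b} \<subseteq> {k<..n + p + 1}"
      using mono_onD[OF mono _ k] by (force simp: not_le)
    then have "knot_mult p n \<xi> b \<le> card {k<..n + p + 1}"
      unfolding knot_mult_def by (intro card_mono) auto
    then show False using mult \<zeta>(3) assms(2) by auto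
  qed
qed

lemma exists_strict_step:
  fixes \<xi> :: "nat \<Rightarrow> real"
  assumes "s \<le> t" "\<xi> s < \<xi> t"
  shows "\<exists>m. s \<le> m \<and> m < t \<and> \<xi> m < \<xi> (m + 1)"
proof (rule ccontr)
  assume no: "\<not> ?thesis"
  have "\<xi> t \<le> \<xi> s"
    using assms(1) no
  proof (induction t rule: dec_induct)
    case (step t)
    then have "\<xi> t \<le> \<xi> s" by (meson less_SucI)
    moreover have "\<xi> (t + 1) \<le> \<xi> t" using step by (meson lessI not_le)
    ultimately show ?case by simp
  qed simp
  then show False using assms(2) by simp
qed

text \<open>
The support of \<open>B\<^sub>i\<close> is nondegenerate and stays so after intersection with the basic interval,
because the first and the last \<open>p + 1\<close> knots coincide with the endpoints.
\<close>

lemma open_knots_active_interval: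
  assumes kn: "open_knots p n a b \<xi>" and i: "i \<in> {1..n}"
  shows "\<exists>m\<in>{p + 1..n}. i \<le> m \<and> m \<le> i + p \<and> \<xi> m < \<xi> (m + 1)"
proof -
  have "p < n" using kn by (simp add: open_knots_def)
  have "\<xi> (max i (p + 1)) = \<xi> i"
    using i open_knots_left[OF kn, of i] open_knots_left[OF kn, of "p + 1"] by (auto simp: max_def)
  moreover have "\<xi> (min (i + p + 1) (n + 1)) = \<xi> (i + p + 1)"
    using i open_knots_right[OF kn, of "i + p + 1"] open_knots_right[OF kn, of "n + 1"]
    by (auto simp: min_def)
  ultimately have "\<xi> (max i (p + 1)) < \<xi> (min (i + p + 1) (n + 1))"
    using open_knots_less[OF kn i] by simp
  moreover have "max i (p + 1) \<le> min (i + p + 1) (n + 1)" using i \<open>p < n\<close> by auto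
  ultimately obtain m where "max i (p + 1) \<le> m" "m < min (i + p + 1) (n + 1)" "\<xi> m < \<xi> (m + 1)"
    using exists_strict_step by metis
  then show ?thesis by (intro bexI[of _ m]) auto
qed

text \<open>
Monotone extension of a knot sequence that is only controlled on \<open>{1..K}\<close>.
\<close>

definition clamp_knots :: "nat \<Rightarrow> (nat \<Rightarrow> real) \<Rightarrow> nat \<Rightarrow> real" where
  "clamp_knots K \<xi> j = \<xi> (max 1 (min j K))"

lemma mono_clamp_knots:
  assumes "mono_on {1..K} \<xi>" "1 \<le> K"
  shows "mono (clamp_knots K \<xi>)"
  unfolding clamp_knots_def using assms(2) by (intro monoI mono_onD[OF assms(1)]) auto

lemma sum_bspline_local:
  assumes "mono \<eta>" "p + 1 \<le> m" "m \<le> n" "\<eta> m < x" "x < \<eta> (m + 1)"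
  shows "(\<Sum>i=1..n. d i * bspline \<eta> p i x) = local_spline \<eta> p (m - p) (\<lambda>j. d (m - p + j)) x"
proof -
  have z: "bspline \<eta> p i x = 0" if "i \<in> {1..n} - {m - p..m}" for i
  proof (cases "i < m - p")
    case True
    then have "\<eta> (i + p + 1) \<le> \<eta> m" by (intro monoD[OF assms(1)]) simp
    then show ?thesis using assms(4) by (intro bspline_eq_0_above[OF assms(1)]) simp
  next
    case False
    then have "\<eta> (m + 1) \<le> \<eta> i" using that by (intro monoD[OF assms(1)]) auto
    then show ?thesis using assms(5) by (intro bspline_eq_0_below[OF assms(1)]) simp
  qed
  have "(\<Sum>i=1..n. d i * bspline \<eta> p i x) = (\<Sum>i\<in>{m - p..m}. d i * bspline \<eta> p i x)"
    using assms(2,3) z by (intro sum.mono_neutral_right) auto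
  also have "\<dots> = (\<Sum>j\<le>p. d (m - p + j) * bspline \<eta> p (m - p + j) x)"
    by (rule sum.reindex_bij_witness[where i = "\<lambda>j. m - p + j" and j = "\<lambda>i. i - (m - p)"])
      (use assms(2) in auto)
  finally show ?thesis by (simp add: local_spline_def)
qed

definition bspline_comb :: "nat \<Rightarrow> nat \<Rightarrow> (nat \<Rightarrow> real) \<Rightarrow> (nat \<Rightarrow> real) \<Rightarrow> real \<Rightarrow> real" where
  "bspline_comb p n \<xi> c x = (\<Sum>j<n. c j * vec_index (bspline_vec p n \<xi> x) j)"

text \<open>
The coefficients of \<open>bspline_comb p n \<xi> c\<close> in the basis \<open>B\<^sub>1, \<dots>, B\<^sub>n\<close>, obtained by writing the
constant function as \<open>B\<^sub>1 + \<dots> + B\<^sub>n\<close>.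
\<close>

definition shifted_coeff :: "(nat \<Rightarrow> real) \<Rightarrow> nat \<Rightarrow> real" where
  "shifted_coeff c i = c 0 + (if i = 1 then 0 else c (i - 1))"

lemma bspline_comb_local:
  assumes kn: "open_knots p n a b \<xi>" and m: "m \<in> {p + 1..n}"
    and x: "\<xi> m < x" "x < \<xi> (m + 1)"
  defines "\<eta> \<equiv> clamp_knots (n + p + 1) \<xi>"
  shows "bspline_comb p n \<xi> c x = local_spline \<eta> p (m - p) (\<lambda>j. shifted_coeff c (m - p + j)) x"
proof -
  have "0 < n" and mono_on: "mono_on {1..n + p + 1} \<xi>"
    using kn by (auto simp: open_knots_def)
  have mono: "mono \<eta>" unfolding \<eta>_def using mono_on by (rule mono_clamp_knots) simp
  have same: "\<eta> i = \<xi> i" if "i \<in> {1..n + p + 1}" for i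
    using that by (auto simp: \<eta>_def clamp_knots_def min_def max_def)
  have x': "\<eta> m < x" "x < \<eta> (m + 1)" using x m same[of m] same[of "m + 1"] by auto
  have B: "bspline \<xi> p i x = bspline \<eta> p i x" if "i \<in> {1..n}" for i
    by (rule bspline_cong, rule same[symmetric]) (use that in auto)
  have one: "(\<Sum>i=1..n. c 0 * bspline \<eta> p i x) = c 0"
  proof -
    have "(\<Sum>i=1..n. c 0 * bspline \<eta> p i x) = local_spline \<eta> p (m - p) (\<lambda>_. c 0) x"
      using m x' by (intro sum_bspline_local mono) auto
    also have "\<dots> = c 0" using m x' by (intro local_spline_const mono) auto
    finally show ?thesis .
  qed
  have "bspline_comb p n \<xi> c x
      = (\<Sum>j<n. (if j = 0 then c 0 else 0) + (if j = 0 then 0 else c j) * bspline \<eta> p (Suc j) x)"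
    unfolding bspline_comb_def bspline_vec_def by (intro sum.cong refl) (auto simp: B)
  also have "\<dots> = c 0 + (\<Sum>j<n. (if j = 0 then 0 else c j) * bspline \<eta> p (Suc j) x)"
    using \<open>0 < n\<close> by (simp add: sum.distrib)
  also have "\<dots> = (\<Sum>i=1..n. c 0 * bspline \<eta> p i x)
      + (\<Sum>i=1..n. (if i = 1 then 0 else c (i - 1)) * bspline \<eta> p i x)"
    unfolding one by (simp add: sum.atLeast1_atMost_eq cong: if_cong)
  also have "\<dots> = (\<Sum>i=1..n. shifted_coeff c i * bspline \<eta> p i x)"
    by (simp add: shifted_coeff_def distrib_right sum.distrib)
  also have "\<dots> = local_spline \<eta> p (m - p) (\<lambda>j. shifted_coeff c (m - p + j)) x"
    using m x' by (intro sum_bspline_local mono) auto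
  finally show ?thesis .
qed

lemma bspline_comb_continuous:
  assumes kn: "open_knots p n a b \<xi>" and m: "m \<in> {p + 1..n}"
  shows "continuous_on {\<xi> m<..<\<xi> (m + 1)} (bspline_comb p n \<xi> c)"
proof -
  define \<eta> where "\<eta> = clamp_knots (n + p + 1) \<xi>"
  have "mono_on {1..n + p + 1} \<xi>" using kn by (auto simp: open_knots_def)
  then have mono: "mono \<eta>" unfolding \<eta>_def by (rule mono_clamp_knots) simp
  have same: "\<eta> m = \<xi> m" "\<eta> (m + 1) = \<xi> (m + 1)"
    using m by (auto simp: \<eta>_def clamp_knots_def min_def max_def)
  have "continuous_on {\<xi> m<..<\<xi> (m + 1)}
      (local_spline \<eta> p (m - p) (\<lambda>j. shifted_coeff c (m - p + j)))"
    using m same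
    by (intro continuous_at_imp_continuous_on ballI DERIV_isCont[OF local_spline_deriv[OF mono]]) auto
  then show ?thesis
    by (rule continuous_on_eq) (auto simp: bspline_comb_local[OF kn m] \<eta>_def)
qed

lemma bspline_comb_independent:
  assumes kn: "open_knots p n a b \<xi>"
    and zero: "\<And>m x. m \<in> {p + 1..n} \<Longrightarrow> \<xi> m < x \<Longrightarrow> x < \<xi> (m + 1) \<Longrightarrow> bspline_comb p n \<xi> c x = 0"
    and "j < n"
  shows "c j = 0"
proof -
  define \<eta> where "\<eta> = clamp_knots (n + p + 1) \<xi>"
  have "mono_on {1..n + p + 1} \<xi>" using kn by (auto simp: open_knots_def)
  then have mono: "mono \<eta>" unfolding \<eta>_def by (rule mono_clamp_knots) simp
  have s: "shifted_coeff c i = 0" if i: "i \<in> {1..n}" for i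
  proof -
    obtain m where m: "m \<in> {p + 1..n}" "i \<le> m" "m \<le> i + p" "\<xi> m < \<xi> (m + 1)"
      using open_knots_active_interval[OF kn i] by blast
    have same: "\<eta> m = \<xi> m" "\<eta> (m + 1) = \<xi> (m + 1)"
      using m by (auto simp: \<eta>_def clamp_knots_def min_def max_def)
    have mp: "m - p + p = m" using m(1) by simp
    have "shifted_coeff c (m - p + (i - (m - p))) = 0"
    proof (rule local_spline_independent[OF mono, where l = "m - p" and p = p
          and c = "\<lambda>j. shifted_coeff c (m - p + j)" and j = "i - (m - p)"])
      show "\<eta> (m - p + p) < \<eta> (m - p + p + 1)" unfolding mp same by (rule m(4))
      show "i - (m - p) \<le> p" using m by auto
      show "local_spline \<eta> p (m - p) (\<lambda>j. shifted_coeff c (m - p + j)) x = 0"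
        if "\<eta> (m - p + p) < x" "x < \<eta> (m - p + p + 1)" for x
        using zero[OF m(1)] bspline_comb_local[OF kn m(1)] that
        unfolding mp same \<eta>_def[symmetric] by metis
    qed
    moreover have "m - p + (i - (m - p)) = i" using m by auto
    ultimately show ?thesis by simp
  qed
  have "c 0 = 0" using s[of 1] assms(3) by (simp add: shifted_coeff_def)
  then show ?thesis using s[of "j + 1"] assms(3) by (cases j) (simp_all add: shifted_coeff_def)
qed

lemma bspline_comb_measurable [measurable]: "bspline_comb p n \<xi> c \<in> borel_measurable borel"
  unfolding bspline_comb_def bspline_vec_def by (intro borel_measurable_sum) auto

lemma bspline_vec_bounded: "\<exists>C. \<forall>x\<in>{a..b}. \<bar>vec_index (bspline_vec p n \<xi> x) j\<bar> \<le> C" if "j < n"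
proof (cases "j = 0")
  case True
  then show ?thesis using that by (intro exI[of _ 1]) (auto simp: bspline_vec_def)
next
  case False
  then show ?thesis using that bspline_bounded_on_interval[of a b \<xi> p "j + 1"]
    by (auto simp: bspline_vec_def)
qed

lemma bspline_comb_bounded: "\<exists>C. \<forall>x\<in>{a..b}. \<bar>bspline_comb p n \<xi> c x\<bar> \<le> C"
proof -
  obtain C where C: "\<And>j x. j < n \<Longrightarrow> x \<in> {a..b} \<Longrightarrow> \<bar>vec_index (bspline_vec p n \<xi> x) j\<bar> \<le> C j"
    using bspline_vec_bounded[of _ n a b p \<xi>] by metis
  have "\<bar>bspline_comb p n \<xi> c x\<bar> \<le> (\<Sum>j<n. \<bar>c j\<bar> * C j)" if "x \<in> {a..b}" for x
    unfolding bspline_comb_def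
    by (rule order_trans[OF sum_abs], intro sum_mono) (auto simp: abs_mult intro!: mult_left_mono C that)
  then show ?thesis by blast
qed

text \<open>
If the combination were nonzero at a point of an open knot interval, it would be nonzero on an open
neighbourhood. This neighbourhood contains a point where the density is nonzero, hence a nonempty
open set on which both are nonzero, and such a set has positive Lebesgue measure.
\<close>

lemma (in prob_space) bspline_comb_L2_definite:
  assumes kn: "open_knots p n a b \<xi>"
    and f: "distributed M lborel Z (\<lambda>x. ennreal (f x))" "\<And>x. 0 \<le> f x"
    and f_cont: "continuous_on {a..b} f" and f_supp: "closure {x. f x \<noteq> 0} = {a..b}"
    and zero: "AE \<omega> in M. bspline_comb p n \<xi> c (Z \<omega>) = 0"
    and "j < n"
  shows "c j = 0"
proof (rule bspline_comb_independent[OF kn _ assms(7)])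
  let ?g = "bspline_comb p n \<xi> c"
  fix m x assume m: "m \<in> {p + 1..n}" and x: "\<xi> m < x" "x < \<xi> (m + 1)"
  have mono: "mono_on {1..n + p + 1} \<xi>" using kn by (auto simp: open_knots_def)
  have ends: "a \<le> \<xi> m" "\<xi> (m + 1) \<le> b"
    using open_knots_left[OF kn, of "p + 1"] open_knots_right[OF kn, of "n + 1"] m
      mono_onD[OF mono, of "p + 1" m] mono_onD[OF mono, of "m + 1" "n + 1"] by auto
  have Z [measurable]: "Z \<in> measurable M lborel" and fm: "(\<lambda>x. ennreal (f x)) \<in> borel_measurable lborel"
    and distr: "distr M lborel Z = density lborel (\<lambda>x. ennreal (f x))"
    using f(1) by (auto simp: distributed_def)
  have "AE t in distr M lborel Z. ?g t = 0"
    using zero Z by (subst AE_distr_iff) auto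
  then have ae: "AE t in lborel. 0 < f t \<longrightarrow> ?g t = 0"
    unfolding distr AE_density[OF fm] by simp
  show "?g x = 0"
  proof (rule ccontr)
    assume nz: "?g x \<noteq> 0"
    define U where "U = {\<xi> m<..<\<xi> (m + 1)} \<inter> ?g -` (- {0})"
    have U: "open U" unfolding U_def
      by (intro continuous_open_preimage bspline_comb_continuous[OF kn m]) auto
    have U_sub: "U \<subseteq> {a..b}" unfolding U_def using ends by auto
    have "x \<in> U \<inter> closure {x. f x \<noteq> 0}"
      unfolding f_supp using nz x ends by (auto simp: U_def)
    then have ne: "U \<inter> {x. f x \<noteq> 0} \<noteq> {}" using open_Int_closure_eq_empty[OF U] by blast
    define V where "V = U \<inter> f -` (- {0})"
    have V: "open V" unfolding V_def
      by (intro continuous_open_preimage continuous_on_subset[OF f_cont] U U_sub) auto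
    have "AE t in lborel. t \<notin> V"
      using ae by eventually_elim (use f(2) in \<open>auto simp: V_def U_def less_le\<close>)
    then have "V \<in> null_sets lborel"
      using V by (subst AE_iff_null_sets) auto
    then have "negligible V"
      unfolding negligible_iff_null_sets by (rule null_sets_completionI)
    then show False using open_not_negligible[OF V] ne by (auto simp: V_def)
  qed
qed

section \<open>Cholesky factorization\<close>

definition quad_form :: "nat \<Rightarrow> (nat \<Rightarrow> nat \<Rightarrow> real) \<Rightarrow> (nat \<Rightarrow> real) \<Rightarrow> (nat \<Rightarrow> real) \<Rightarrow> real" where
  "quad_form n g c d = (\<Sum>i<n. \<Sum>j<n. c i * d j * g i j)"

lemma quad_form_diff_left:
  "quad_form n g (\<lambda>i. c i - c' i) d = quad_form n g c d - quad_form n g c' d"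
  by (simp add: quad_form_def left_diff_distrib sum_subtractf)

lemma quad_form_add_left:
  "quad_form n g (\<lambda>i. c i + c' i) d = quad_form n g c d + quad_form n g c' d"
  by (simp add: quad_form_def distrib_right sum.distrib)

lemma quad_form_scale_left: "quad_form n g (\<lambda>i. r * c i) d = r * quad_form n g c d"
  by (simp add: quad_form_def sum_distrib_left mult.assoc)

lemma quad_form_sum_left:
  fixes m :: nat
  shows "quad_form n g (\<lambda>i. \<Sum>k<m. \<alpha> k * r k i) d = (\<Sum>k<m. \<alpha> k * quad_form n g (r k) d)"
proof (induction m)
  case 0
  show ?case by (simp add: quad_form_def)
next
  case (Suc m)
  then show ?case by (simp add: quad_form_add_left quad_form_scale_left)
qed

lemma quad_form_commute:
  assumes "\<And>i j. i < n \<Longrightarrow> j < n \<Longrightarrow> g i j = g j i"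
  shows "quad_form n g c d = quad_form n g d c"
  unfolding quad_form_def
  by (subst sum.swap, intro sum.cong refl) (auto simp: assms)

text \<open>
Gram-Schmidt applied to the unit vectors \<open>e\<^sub>0, e\<^sub>1, \<dots>\<close> in the inner product given by \<open>g\<close>. The vector
\<open>r\<^sub>m\<close> is a combination of \<open>e\<^sub>0, \<dots>, e\<^sub>m\<close> with a positive coefficient at \<open>e\<^sub>m\<close>, so the rows \<open>r\<^sub>i\<close> form
a lower triangular matrix \<open>R\<close> with \<open>R G R\<^sup>T = 1\<close>: this is the inverse of the Cholesky factor.
\<close>

lemma gram_schmidt_lower_triangular:
  fixes g :: "nat \<Rightarrow> nat \<Rightarrow> real"
  assumes sym: "\<And>i j. i < n \<Longrightarrow> j < n \<Longrightarrow> g i j = g j i"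
    and pd: "\<And>c. \<exists>j<n. c j \<noteq> 0 \<Longrightarrow> quad_form n g c c > 0"
    and "m \<le> n"
  shows "\<exists>r. (\<forall>i<m. r i i > 0 \<and> (\<forall>j>i. r i j = 0)) \<and>
             (\<forall>i<m. \<forall>j<m. quad_form n g (r i) (r j) = (if i = j then 1 else 0))"
  using assms(3)
proof (induction m)
  case (Suc m)
  have comm: "quad_form n g c d = quad_form n g d c" for c d
    by (rule quad_form_commute) (rule sym)
  from Suc.IH Suc_leD[OF Suc.prems] obtain r
    where r: "\<forall>i<m. r i i > 0 \<and> (\<forall>j>i. r i j = 0)"
      "\<forall>i<m. \<forall>j<m. quad_form n g (r i) (r j) = (if i = j then 1 else 0)"
    by (elim exE conjE meta_impE)
  have tri: "r i i > 0" if "i < m" for i using r(1)[rule_format, OF that] ..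
  have tri0: "r i j = 0" if "i < m" "i < j" for i j using r(1)[rule_format, OF that(1)] that(2) by simp
  have orth: "quad_form n g (r i) (r j) = (if i = j then 1 else 0)" if "i < m" "j < m" for i j
    using r(2)[rule_format, OF that] .
  define e :: "nat \<Rightarrow> real" where "e j = (if j = m then 1 else 0)" for j
  define w where "w j = e j - (\<Sum>k<m. quad_form n g e (r k) * r k j)" for j
  have w_tri: "w m = 1" "\<And>j. j > m \<Longrightarrow> w j = 0"
    using tri0 by (simp_all add: w_def e_def)
  have w_orth: "quad_form n g w (r j) = 0" if "j < m" for j
  proof -
    have "(\<Sum>k<m. quad_form n g e (r k) * quad_form n g (r k) (r j))
        = (\<Sum>k<m. if k = j then quad_form n g e (r k) else 0)"
      using that by (intro sum.cong refl) (simp add: orth)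
    also have "\<dots> = quad_form n g e (r j)" using that by simp
    finally show ?thesis
      unfolding w_def[abs_def] by (simp add: quad_form_diff_left quad_form_sum_left)
  qed
  define q where "q = quad_form n g w w"
  have q: "q > 0" unfolding q_def using w_tri(1) Suc.prems by (intro pd exI[of _ m]) auto
  define r' where "r' = r(m := (\<lambda>j. (1 / sqrt q) * w j))"
  have new: "quad_form n g (r' m) d = (1 / sqrt q) * quad_form n g w d" for d
    unfolding r'_def fun_upd_same by (rule quad_form_scale_left)
  have "quad_form n g (r' m) (r' m) = 1"
    using q unfolding new comm[of w "r' m"] by (simp add: new q_def[symmetric])
  moreover have "quad_form n g (r' m) (r' j) = 0" "quad_form n g (r' j) (r' m) = 0" if "j < m" for j
    using w_orth[OF that] that unfolding comm[of "r' j" "r' m"] new by (simp_all add: r'_def)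
  moreover have "quad_form n g (r' i) (r' j) = (if i = j then 1 else 0)" if "i < m" "j < m" for i j
    using orth[OF that] that by (simp add: r'_def)
  ultimately have "\<forall>i<Suc m. \<forall>j<Suc m. quad_form n g (r' i) (r' j) = (if i = j then 1 else 0)"
    by (auto simp: less_Suc_eq)
  moreover have "\<forall>i<Suc m. r' i i > 0 \<and> (\<forall>j>i. r' i j = 0)"
  proof (intro allI impI conjI)
    show "r' i i > 0" if "i < Suc m" for i
      using that tri[of i] w_tri(1) q by (cases "i = m") (simp_all add: r'_def)
    show "r' i j = 0" if "i < Suc m" "i < j" for i j
      using that tri0[of i j] w_tri(2)[of j] by (cases "i = m") (simp_all add: r'_def)
  qed
  ultimately show ?case by blast
qed auto

lemma index_triple_product_transpose:
  assumes "A \<in> carrier_mat n n" "G \<in> carrier_mat n n" "i < n" "j < n"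
  shows "(A * G * transpose_mat A) $$ (i, j)
       = quad_form n (\<lambda>k l. G $$ (k, l)) (\<lambda>k. A $$ (i, k)) (\<lambda>k. A $$ (j, k))"
proof -
  have "(A * G * transpose_mat A) $$ (i, j)
      = (\<Sum>k<n. A $$ (i, k) * (\<Sum>l<n. G $$ (k, l) * A $$ (j, l)))"
    using assms by (simp add: scalar_prod_def lessThan_atLeast0)
  also have "\<dots> = quad_form n (\<lambda>k l. G $$ (k, l)) (\<lambda>k. A $$ (i, k)) (\<lambda>k. A $$ (j, k))"
    unfolding quad_form_def sum_distrib_left by (simp add: mult_ac)
  finally show ?thesis .
qed

text \<open>
Triangularity cuts the matrix product off at column \<open>j\<close>; for \<open>i = j\<close> this determines the diagonal
entry, and then for the other \<open>i\<close> the remaining entries of the column, from the earlier columns.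
\<close>

lemma is_cholesky_index:
  assumes "is_cholesky G Q" "j < dim_row G" "i < dim_row G"
  shows "G $$ (i, j) = (\<Sum>k<j. Q $$ (i, k) * Q $$ (j, k)) + Q $$ (i, j) * Q $$ (j, j)"
proof -
  let ?n = "dim_row G"
  have Q: "Q \<in> carrier_mat ?n ?n" and G: "G = Q * transpose_mat Q"
    and tri: "\<And>i j. i < ?n \<Longrightarrow> j < ?n \<Longrightarrow> i < j \<Longrightarrow> Q $$ (i, j) = 0"
    using assms(1) unfolding is_cholesky_def by blast+
  have "G $$ (i, j) = (Q * transpose_mat Q) $$ (i, j)" using G by simp
  also have "\<dots> = (\<Sum>k<?n. Q $$ (i, k) * Q $$ (j, k))"
    using Q assms(2,3) by (simp add: scalar_prod_def lessThan_atLeast0)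
  also have "\<dots> = (\<Sum>k<Suc j. Q $$ (i, k) * Q $$ (j, k))"
    using assms(2) tri[of j] by (intro sum.mono_neutral_right) auto
  finally show ?thesis by simp
qed

lemma is_cholesky_unique:
  assumes "is_cholesky G Q" "is_cholesky G Q'"
  shows "Q = Q'"
proof -
  let ?n = "dim_row G"
  have dims: "Q \<in> carrier_mat ?n ?n" "Q' \<in> carrier_mat ?n ?n"
    and tri: "\<And>i j. i < ?n \<Longrightarrow> j < ?n \<Longrightarrow> i < j \<Longrightarrow> Q $$ (i, j) = 0"
      "\<And>i j. i < ?n \<Longrightarrow> j < ?n \<Longrightarrow> i < j \<Longrightarrow> Q' $$ (i, j) = 0"
    and pos: "\<And>i. i < ?n \<Longrightarrow> Q $$ (i, i) > 0" "\<And>i. i < ?n \<Longrightarrow> Q' $$ (i, i) > 0"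
    using assms unfolding is_cholesky_def by blast+
  have col: "\<forall>i<?n. Q $$ (i, j) = Q' $$ (i, j)" if "j < ?n" for j
    using that
  proof (induction j rule: less_induct)
    case (less j)
    have IH: "Q $$ (i, k) = Q' $$ (i, k)" if "k < j" "i < ?n" for i k
      using less that by auto
    have eq: "Q $$ (i, j) * Q $$ (j, j) = Q' $$ (i, j) * Q' $$ (j, j)" if "i < ?n" for i
      using is_cholesky_index[OF assms(1) less.prems that]
        is_cholesky_index[OF assms(2) less.prems that] IH that less.prems by simp
    have "(Q $$ (j, j))\<^sup>2 = (Q' $$ (j, j))\<^sup>2"
      using eq[OF less.prems] by (simp add: power2_eq_square)
    then have "Q $$ (j, j) = Q' $$ (j, j)"
      using pos less.prems by (simp add: less_imp_le power2_eq_iff_nonneg)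
    then show ?case using eq pos(2)[OF less.prems] by auto
  qed
  show ?thesis using dims col by (intro eq_matI) auto
qed

text \<open>
The factor is the inverse of the Gram-Schmidt matrix \<open>R\<close>, explicitly \<open>G R\<^sup>T\<close>. That the inverse of a
lower triangular matrix with positive diagonal is again of this kind follows by forward
substitution in \<open>R Q = 1\<close>.
\<close>

lemma is_cholesky_exists:
  assumes G: "G \<in> carrier_mat n n"
    and sym: "\<And>i j. i < n \<Longrightarrow> j < n \<Longrightarrow> G $$ (i, j) = G $$ (j, i)"
    and pd: "\<And>c. \<exists>j<n. c j \<noteq> 0 \<Longrightarrow> quad_form n (\<lambda>i j. G $$ (i, j)) c c > 0"
  shows "\<exists>Q. is_cholesky G Q"
proof -
  obtain r where tri: "\<And>i. i < n \<Longrightarrow> r i i > 0" "\<And>i j. i < n \<Longrightarrow> i < j \<Longrightarrow> r i j = 0"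
    and orth: "\<And>i j. i < n \<Longrightarrow> j < n \<Longrightarrow>
      quad_form n (\<lambda>i j. G $$ (i, j)) (r i) (r j) = (if i = j then 1 else 0)"
    using gram_schmidt_lower_triangular[where g = "\<lambda>i j. G $$ (i, j)", OF sym pd order_refl] by blast
  define R where "R = Matrix.mat n n (\<lambda>(i, j). r i j)"
  have R: "R \<in> carrier_mat n n" by (simp add: R_def)
  have Rt: "transpose_mat R \<in> carrier_mat n n" using R by simp
  have RGR: "R * G * transpose_mat R = 1\<^sub>m n"
  proof (rule eq_matI)
    fix i j assume "i < dim_row (1\<^sub>m n)" "j < dim_col (1\<^sub>m n)"
    then have ij: "i < n" "j < n" by auto
    have "(R * G * transpose_mat R) $$ (i, j)
        = quad_form n (\<lambda>i j. G $$ (i, j)) (r i) (r j)"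
      unfolding index_triple_product_transpose[OF R G ij] unfolding quad_form_def
      by (intro sum.cong refl) (simp add: R_def ij)
    then show "(R * G * transpose_mat R) $$ (i, j) = 1\<^sub>m n $$ (i, j)"
      using orth ij by simp
  qed (use R in auto)
  define Q where "Q = G * transpose_mat R"
  have Q: "Q \<in> carrier_mat n n" using G R by (simp add: Q_def)
  have RQ: "R * Q = 1\<^sub>m n"
    unfolding Q_def using RGR assoc_mult_mat[OF R G Rt] by simp
  have QR: "Q * R = 1\<^sub>m n" by (rule mat_mult_left_right_inverse[OF R Q RQ])
  have RtQt: "transpose_mat R * transpose_mat Q = 1\<^sub>m n"
    using transpose_mult[OF Q R] QR by simp
  have Qt: "transpose_mat Q \<in> carrier_mat n n" using Q by simp
  have GQ: "G = Q * transpose_mat Q"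
    using assoc_mult_mat[OF G Rt Qt] right_mult_one_mat[OF G] unfolding RtQt Q_def[symmetric] by simp
  have RQ_index: "(\<Sum>k<i. r i k * Q $$ (k, j)) + r i i * Q $$ (i, j) = (if i = j then 1 else 0)"
    if "i < n" "j < n" for i j
  proof -
    have "(if i = j then 1 else 0) = (R * Q) $$ (i, j)" using RQ that by simp
    also have "\<dots> = (\<Sum>k<n. r i k * Q $$ (k, j))"
      using R Q that by (simp add: scalar_prod_def lessThan_atLeast0 R_def)
    also have "\<dots> = (\<Sum>k<Suc i. r i k * Q $$ (k, j))"
      using that tri(2) by (intro sum.mono_neutral_right) auto
    finally show ?thesis by simp
  qed
  have Qtri: "Q $$ (i, j) = 0" if "i < j" "j < n" for i j
    using that
  proof (induction i rule: less_induct)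
    case (less i)
    have "(\<Sum>k<i. r i k * Q $$ (k, j)) = 0" using less by (intro sum.neutral) auto
    then show ?case using RQ_index[of i j] tri(1)[of i] less.prems by simp
  qed
  have Qpos: "Q $$ (i, i) > 0" if "i < n" for i
  proof -
    have "(\<Sum>k<i. r i k * Q $$ (k, i)) = 0" using Qtri that by (intro sum.neutral) auto
    then have "r i i * Q $$ (i, i) = 1" using RQ_index[of i i] that by simp
    then show ?thesis using zero_less_mult_pos[of "r i i" "Q $$ (i, i)"] tri(1)[OF that] by simp
  qed
  have "is_cholesky G Q"
    unfolding is_cholesky_def using G Q Qtri Qpos GQ by auto
  then show ?thesis ..
qed

text \<open>
With \<open>B = Q\<^sup>-\<^sup>1\<close> one has \<open>B G = Q\<^sup>T\<close>, which is upper triangular. The zeros below its diagonal say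
that each orthonormalized function is orthogonal to all earlier functions of the original system.
\<close>

lemma cholesky_whitening:
  assumes G: "G \<in> carrier_mat n n"
    and sym: "\<And>i j. i < n \<Longrightarrow> j < n \<Longrightarrow> G $$ (i, j) = G $$ (j, i)"
    and pd: "\<And>c. \<exists>j<n. c j \<noteq> 0 \<Longrightarrow> quad_form n (\<lambda>i j. G $$ (i, j)) c c > 0"
  defines "B \<equiv> the (mat_inverse (cholesky G))"
  shows "B \<in> carrier_mat n n" "B * G * transpose_mat B = 1\<^sub>m n"
    and "\<And>i j. j < i \<Longrightarrow> i < n \<Longrightarrow> (B * G) $$ (i, j) = 0"
proof -
  define Q where "Q = cholesky G"
  have "\<exists>Q. is_cholesky G Q" by (rule is_cholesky_exists[OF G]) (fact sym pd)+
  then have "\<exists>!Q. is_cholesky G Q" by (rule ex_ex1I) (rule is_cholesky_unique)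
  then have "is_cholesky G Q" unfolding Q_def cholesky_def by (rule theI')
  then have Q: "Q \<in> carrier_mat n n" and GQ: "G = Q * transpose_mat Q"
    and tri: "\<And>i j. i < n \<Longrightarrow> j < n \<Longrightarrow> i < j \<Longrightarrow> Q $$ (i, j) = 0"
    and pos: "\<And>i. i < n \<Longrightarrow> Q $$ (i, i) > 0"
    using G unfolding is_cholesky_def by auto
  have Qt: "transpose_mat Q \<in> carrier_mat n n" using Q by simp
  have "prod_list (diag_mat Q) \<noteq> 0"
    using pos Q by (auto simp: prod_list_zero_iff diag_mat_def) (metis less_irrefl)
  then have "det Q \<noteq> 0" using det_lower_triangular[of n Q] tri Q by simp
  then have "mat_inverse Q \<noteq> None"
    using mat_inverse(1)[OF Q, where b = "()"] det_non_zero_imp_unit[OF Q, where b = "()"] by blast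
  then obtain B' where "mat_inverse Q = Some B'" by auto
  with mat_inverse(2)[OF Q this] have B: "B \<in> carrier_mat n n" and BQ: "B * Q = 1\<^sub>m n"
    by (simp_all add: B_def Q_def)
  have BG: "B * G = transpose_mat Q"
    unfolding GQ using assoc_mult_mat[OF B Q Qt] BQ Qt by simp
  show "B \<in> carrier_mat n n" by (rule B)
  show "B * G * transpose_mat B = 1\<^sub>m n"
    unfolding BG using transpose_mult[OF B Q] BQ by simp
  show "(B * G) $$ (i, j) = 0" if "j < i" "i < n" for i j
    unfolding BG using Q tri[of j i] that by simp
qed

section \<open>Orthonormalized B-splines\<close>

lemma (in prob_space) integrable_bounded_compose:
  fixes g :: "real \<Rightarrow> real"
  assumes "g \<in> borel_measurable borel" "Z \<in> borel_measurable M"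
    and "Z \<in> space M \<rightarrow> S" "\<exists>C. \<forall>x\<in>S. \<bar>g x\<bar> \<le> C"
  shows "integrable M (\<lambda>\<omega>. g (Z \<omega>))"
proof -
  obtain C where "\<And>x. x \<in> S \<Longrightarrow> \<bar>g x\<bar> \<le> C" using assms(4) by blast
  then show ?thesis
    using assms(1-3) by (intro integrable_const_bound[where B = C] AE_I2) auto
qed

lemma bounded_mult:
  fixes g h :: "'b \<Rightarrow> real"
  assumes "\<exists>C. \<forall>x\<in>S. \<bar>g x\<bar> \<le> C" "\<exists>C. \<forall>x\<in>S. \<bar>h x\<bar> \<le> C"
  shows "\<exists>C. \<forall>x\<in>S. \<bar>g x * h x\<bar> \<le> C"
proof -
  obtain C D where "\<And>x. x \<in> S \<Longrightarrow> \<bar>g x\<bar> \<le> C" "\<And>x. x \<in> S \<Longrightarrow> \<bar>h x\<bar> \<le> D"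
    using assms by blast
  then have "\<bar>g x * h x\<bar> \<le> C * D" if "x \<in> S" for x
    unfolding abs_mult using that by (intro mult_mono') auto
  then show ?thesis by blast
qed

lemma (in prob_space) expectation_bspline_comb_mult:
  assumes Z: "Z \<in> borel_measurable M" "Z \<in> space M \<rightarrow> {a..b}"
  shows "expectation (\<lambda>\<omega>. bspline_comb p n \<xi> c (Z \<omega>) * bspline_comb p n \<xi> d (Z \<omega>))
       = quad_form n (\<lambda>i j. gram_mat M Z p n \<xi> $$ (i, j)) c d"
proof -
  let ?P = "\<lambda>j x. vec_index (bspline_vec p n \<xi> x) j"
  have meas: "?P j \<in> borel_measurable borel" if "j < n" for j
    using that by (simp add: bspline_vec_def)
  have int: "integrable M (\<lambda>\<omega>. ?P i (Z \<omega>) * ?P j (Z \<omega>))" if "i < n" "j < n" for i j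
    using that
    by (intro integrable_bounded_compose[OF _ Z, of "\<lambda>x. ?P i x * ?P j x"]
        borel_measurable_times meas bounded_mult bspline_vec_bounded)
  have "expectation (\<lambda>\<omega>. bspline_comb p n \<xi> c (Z \<omega>) * bspline_comb p n \<xi> d (Z \<omega>))
      = expectation (\<lambda>\<omega>. \<Sum>i<n. \<Sum>j<n. c i * d j * (?P i (Z \<omega>) * ?P j (Z \<omega>)))"
    by (simp add: bspline_comb_def sum_product mult_ac)
  also have "\<dots> = (\<Sum>i<n. expectation (\<lambda>\<omega>. \<Sum>j<n. c i * d j * (?P i (Z \<omega>) * ?P j (Z \<omega>))))"
    by (intro Bochner_Integration.integral_sum Bochner_Integration.integrable_sum
        integrable_mult_right int) auto
  also have "\<dots> = (\<Sum>i<n. \<Sum>j<n. expectation (\<lambda>\<omega>. c i * d j * (?P i (Z \<omega>) * ?P j (Z \<omega>))))"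
    by (intro sum.cong refl Bochner_Integration.integral_sum integrable_mult_right int) auto
  also have "\<dots> = quad_form n (\<lambda>i j. gram_mat M Z p n \<xi> $$ (i, j)) c d"
    unfolding quad_form_def
    by (intro sum.cong refl) (simp add: gram_mat_def del: mult_cancel_left)
  finally show ?thesis .
qed

text \<open>
The quadratic form of the Gram matrix at \<open>c\<close> is the second moment of the combination with
coefficients \<open>c\<close>, which vanishes only for \<open>c = 0\<close>.
\<close>

lemma (in prob_space) gram_mat_whitening:
  assumes kn: "open_knots p n a b \<xi>"
    and f: "distributed M lborel Z (\<lambda>x. ennreal (f x))" "\<And>x. 0 \<le> f x"
    and f_cont: "continuous_on {a..b} f" and f_supp: "closure {x. f x \<noteq> 0} = {a..b}"
    and Z: "Z \<in> space M \<rightarrow> {a..b}"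
  defines "G \<equiv> gram_mat M Z p n \<xi>"
  defines "B \<equiv> the (mat_inverse (cholesky G))"
  shows "B \<in> carrier_mat n n" "B * G * transpose_mat B = 1\<^sub>m n"
    and "\<And>i j. j < i \<Longrightarrow> i < n \<Longrightarrow> (B * G) $$ (i, j) = 0"
proof -
  have Zm: "Z \<in> borel_measurable M" using f(1) by (simp add: distributed_def)
  have G: "G \<in> carrier_mat n n" by (simp add: G_def gram_mat_def)
  have sym: "G $$ (i, j) = G $$ (j, i)" if "i < n" "j < n" for i j
    using that by (simp add: G_def gram_mat_def mult.commute)
  have pd: "quad_form n (\<lambda>i j. G $$ (i, j)) c c > 0" if nz: "\<exists>j<n. c j \<noteq> 0" for c
  proof -
    let ?g = "\<lambda>\<omega>. bspline_comb p n \<xi> c (Z \<omega>) * bspline_comb p n \<xi> c (Z \<omega>)"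
    have "integrable M ?g"
      by (intro integrable_bounded_compose[OF _ Zm Z,
            of "\<lambda>x. bspline_comb p n \<xi> c x * bspline_comb p n \<xi> c x"]
          bounded_mult bspline_comb_bounded) measurable
    then have "expectation ?g = 0 \<longleftrightarrow> (AE \<omega> in M. ?g \<omega> = 0)"
      by (intro integral_nonneg_eq_0_iff_AE) auto
    moreover have "\<not> (AE \<omega> in M. ?g \<omega> = 0)"
      using bspline_comb_L2_definite[OF kn f f_cont f_supp, of c] nz by auto
    moreover have "expectation ?g \<ge> 0" by (intro Bochner_Integration.integral_nonneg) auto
    ultimately have "expectation ?g > 0" by linarith
    then show ?thesis unfolding G_def expectation_bspline_comb_mult[OF Zm Z] .
  qed
  note * = cholesky_whitening[OF G sym pd, folded B_def]
  show "B \<in> carrier_mat n n" "B * G * transpose_mat B = 1\<^sub>m n"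
    "\<And>i j. j < i \<Longrightarrow> i < n \<Longrightarrow> (B * G) $$ (i, j) = 0"
    using * by blast+
qed

lemma ortho_bspline_eq_comb:
  assumes "the (mat_inverse (cholesky (gram_mat M Z p n \<xi>))) \<in> carrier_mat n n" "i \<in> {1..n}"
  shows "ortho_bspline M Z p n \<xi> i
       = bspline_comb p n \<xi> (\<lambda>j. the (mat_inverse (cholesky (gram_mat M Z p n \<xi>))) $$ (i - 1, j))"
proof
  fix x
  have "dim_vec (bspline_vec p n \<xi> x) = n" by (simp add: bspline_vec_def)
  then show "ortho_bspline M Z p n \<xi> i x = bspline_comb p n \<xi>
      (\<lambda>j. the (mat_inverse (cholesky (gram_mat M Z p n \<xi>))) $$ (i - 1, j)) x"
    using assms unfolding ortho_bspline_def bspline_comb_def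
    by (auto simp: scalar_prod_def lessThan_atLeast0 intro!: sum.cong)
qed

text \<open>
The mean of \<open>\<psi>\<^sub>i\<close> is its inner product with the constant function, the first component of \<open>P\<close>, and
so an entry of \<open>B G\<close> in the first column, which is zero below the diagonal.
\<close>

lemma (in prob_space) ortho_bspline_orthonormal:
  assumes kn: "open_knots p n a b \<xi>"
    and f: "distributed M lborel Z (\<lambda>x. ennreal (f x))" "\<And>x. 0 \<le> f x"
    and f_cont: "continuous_on {a..b} f" and f_supp: "closure {x. f x \<noteq> 0} = {a..b}"
    and Z: "Z \<in> space M \<rightarrow> {a..b}"
  defines "\<psi> \<equiv> ortho_bspline M Z p n \<xi>"
  shows "\<And>i. i \<in> {1..n} \<Longrightarrow> \<psi> i \<in> borel_measurable borel"
    and "\<And>i. i \<in> {1..n} \<Longrightarrow> integrable M (\<lambda>\<omega>. \<psi> i (Z \<omega>))"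
    and "\<And>i j. i \<in> {1..n} \<Longrightarrow> j \<in> {1..n} \<Longrightarrow> integrable M (\<lambda>\<omega>. \<psi> i (Z \<omega>) * \<psi> j (Z \<omega>))"
    and "\<And>i j. i \<in> {1..n} \<Longrightarrow> j \<in> {1..n} \<Longrightarrow>
           expectation (\<lambda>\<omega>. \<psi> i (Z \<omega>) * \<psi> j (Z \<omega>)) = (if i = j then 1 else 0)"
    and "\<And>i. i \<in> {2..n} \<Longrightarrow> expectation (\<lambda>\<omega>. \<psi> i (Z \<omega>)) = 0"
proof -
  have Zm: "Z \<in> borel_measurable M" using f(1) by (simp add: distributed_def)
  define G where "G = gram_mat M Z p n \<xi>"
  define B where "B = the (mat_inverse (cholesky G))"
  note W = gram_mat_whitening[OF kn f f_cont f_supp Z, folded G_def, folded B_def]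
  have G: "G \<in> carrier_mat n n" by (simp add: G_def gram_mat_def)
  have \<psi>: "\<psi> i = bspline_comb p n \<xi> (\<lambda>j. B $$ (i - 1, j))" if "i \<in> {1..n}" for i
    using ortho_bspline_eq_comb[OF W(1)[unfolded B_def G_def] that]
    by (simp add: \<psi>_def B_def G_def)
  show meas: "\<psi> i \<in> borel_measurable borel" if "i \<in> {1..n}" for i
    unfolding \<psi>[OF that] by measurable
  have bdd: "\<exists>C. \<forall>x\<in>{a..b}. \<bar>\<psi> i x\<bar> \<le> C" if "i \<in> {1..n}" for i
    unfolding \<psi>[OF that] by (rule bspline_comb_bounded)
  show "integrable M (\<lambda>\<omega>. \<psi> i (Z \<omega>))" if "i \<in> {1..n}" for i
    by (intro integrable_bounded_compose[OF meas Zm Z bdd] that)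
  show "integrable M (\<lambda>\<omega>. \<psi> i (Z \<omega>) * \<psi> j (Z \<omega>))" if "i \<in> {1..n}" "j \<in> {1..n}" for i j
    using that by (intro integrable_bounded_compose[OF _ Zm Z, of "\<lambda>x. \<psi> i x * \<psi> j x"]
        bounded_mult bdd borel_measurable_times meas)
  show "expectation (\<lambda>\<omega>. \<psi> i (Z \<omega>) * \<psi> j (Z \<omega>)) = (if i = j then 1 else 0)"
    if "i \<in> {1..n}" "j \<in> {1..n}" for i j
  proof -
    have ij: "i - 1 < n" "j - 1 < n" using that by auto
    have "expectation (\<lambda>\<omega>. \<psi> i (Z \<omega>) * \<psi> j (Z \<omega>)) = (B * G * transpose_mat B) $$ (i - 1, j - 1)"
      unfolding index_triple_product_transpose[OF W(1) G ij]
      unfolding \<psi>[OF that(1)] \<psi>[OF that(2)] expectation_bspline_comb_mult[OF Zm Z] G_def ..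
    then show ?thesis using W(2) ij that by auto
  qed
  show "expectation (\<lambda>\<omega>. \<psi> i (Z \<omega>)) = 0" if i: "i \<in> {2..n}" for i
  proof -
    define e :: "nat \<Rightarrow> real" where "e j = (if j = 0 then 1 else 0)" for j
    have i': "i \<in> {1..n}" "0 < i - 1" "i - 1 < n" using i by auto
    have e: "bspline_comb p n \<xi> e x = 1" for x
    proof -
      have "bspline_comb p n \<xi> e x = (\<Sum>j<n. if j = 0 then 1 else 0)"
        unfolding bspline_comb_def by (intro sum.cong refl) (auto simp: e_def bspline_vec_def)
      then show ?thesis using i' by simp
    qed
    have "expectation (\<lambda>\<omega>. \<psi> i (Z \<omega>))
        = expectation (\<lambda>\<omega>. \<psi> i (Z \<omega>) * bspline_comb p n \<xi> e (Z \<omega>))" by (simp add: e)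
    also have "\<dots> = quad_form n (\<lambda>i j. G $$ (i, j)) (\<lambda>j. B $$ (i - 1, j)) e"
      unfolding \<psi>[OF i'(1)] expectation_bspline_comb_mult[OF Zm Z] G_def ..
    also have "\<dots> = (\<Sum>k<n. \<Sum>j<n. if j = 0 then B $$ (i - 1, k) * G $$ (k, 0) else 0)"
      unfolding quad_form_def by (intro sum.cong refl) (simp add: e_def)
    also have "\<dots> = (B * G) $$ (i - 1, 0)"
      using i' W(1) G by (simp add: scalar_prod_def lessThan_atLeast0)
    also have "\<dots> = 0" using i' by (intro W(3))
    finally show ?thesis .
  qed
qed

section \<open>Tensor products under independence\<close>

text \<open>
Independence turns the expectation into a product over \<open>K\<close> of univariate expectations. If the two
tensor products differ, then at some coordinate either exactly one of them has a factor, which has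
mean zero, or both have factors with different indices, which are orthogonal.
\<close>

lemma (in prob_space) tensor_product_orthonormal:
  fixes X :: "'a \<Rightarrow> 'k \<Rightarrow> real" and \<psi> :: "'k \<Rightarrow> 'i \<Rightarrow> real \<Rightarrow> real"
  assumes "finite K" and indep: "indep_vars (\<lambda>_. borel) (\<lambda>k \<omega>. X \<omega> k) K"
    and meas: "\<And>k i. k \<in> K \<Longrightarrow> i \<in> I k \<Longrightarrow> \<psi> k i \<in> borel_measurable borel"
    and int: "\<And>k i. k \<in> K \<Longrightarrow> i \<in> I k \<Longrightarrow> integrable M (\<lambda>\<omega>. \<psi> k i (X \<omega> k))"
      "\<And>k i j. k \<in> K \<Longrightarrow> i \<in> I k \<Longrightarrow> j \<in> I k \<Longrightarrow>
         integrable M (\<lambda>\<omega>. \<psi> k i (X \<omega> k) * \<psi> k j (X \<omega> k))"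
    and mean: "\<And>k i. k \<in> K \<Longrightarrow> i \<in> I k \<Longrightarrow> expectation (\<lambda>\<omega>. \<psi> k i (X \<omega> k)) = 0"
    and orth: "\<And>k i j. k \<in> K \<Longrightarrow> i \<in> I k \<Longrightarrow> j \<in> I k \<Longrightarrow>
         expectation (\<lambda>\<omega>. \<psi> k i (X \<omega> k) * \<psi> k j (X \<omega> k)) = (if i = j then 1 else 0)"
    and u: "u \<subseteq> K" "i \<in> Pi\<^sub>E u I" and v: "v \<subseteq> K" "j \<in> Pi\<^sub>E v I"
  shows "integrable M (\<lambda>\<omega>. (\<Prod>k\<in>u. \<psi> k (i k) (X \<omega> k)) * (\<Prod>k\<in>v. \<psi> k (j k) (X \<omega> k)))" (is ?int)
    and "expectation (\<lambda>\<omega>. (\<Prod>k\<in>u. \<psi> k (i k) (X \<omega> k)) * (\<Prod>k\<in>v. \<psi> k (j k) (X \<omega> k)))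
       = (if (u, i) = (v, j) then 1 else 0)" (is "?E = _")
proof -
  \<comment> \<open>Padding with the constant 1 lets both products range over the same index set.\<close>
  define h where "h k t = (if k \<in> u then \<psi> k (i k) t else 1) * (if k \<in> v then \<psi> k (j k) t else 1)" for k t
  have ext: "(\<Prod>k\<in>w. \<psi> k (l k) (X \<omega> k)) = (\<Prod>k\<in>K. if k \<in> w then \<psi> k (l k) (X \<omega> k) else 1)"
    if "w \<subseteq> K" for w l \<omega>
    using that assms(1) by (simp add: prod.If_cases Int_absorb1)
  have prod_eq: "(\<Prod>k\<in>u. \<psi> k (i k) (X \<omega> k)) * (\<Prod>k\<in>v. \<psi> k (j k) (X \<omega> k)) = (\<Prod>k\<in>K. h k (X \<omega> k))" for \<omega>
    unfolding ext[OF u(1)] ext[OF v(1)] h_def by (simp add: prod.distrib)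
  have iI: "i k \<in> I k" if "k \<in> u" for k using u(2) that by auto
  have jI: "j k \<in> I k" if "k \<in> v" for k using v(2) that by auto
  have "h k \<in> borel_measurable borel" if "k \<in> K" for k
    using that unfolding h_def[abs_def]
    by (cases "k \<in> u"; cases "k \<in> v") (auto intro!: borel_measurable_times meas iI jI)
  then have "indep_vars (\<lambda>_. borel) (\<lambda>k \<omega>. h k (X \<omega> k)) K"
    by (rule indep_vars_compose2[OF indep])
  moreover have h_int: "integrable M (\<lambda>\<omega>. h k (X \<omega> k))" if "k \<in> K" for k
    using that int iI[of k] jI[of k] by (cases "k \<in> u"; cases "k \<in> v") (simp_all add: h_def)
  ultimately have E: "integrable M (\<lambda>\<omega>. \<Prod>k\<in>K. h k (X \<omega> k))"
    "expectation (\<lambda>\<omega>. \<Prod>k\<in>K. h k (X \<omega> k)) = (\<Prod>k\<in>K. expectation (\<lambda>\<omega>. h k (X \<omega> k)))"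
    using assms(1) by (auto intro!: indep_vars_integrable indep_vars_lebesgue_integral)
  show ?int unfolding prod_eq by (rule E(1))
  have h_E: "expectation (\<lambda>\<omega>. h k (X \<omega> k)) =
      (if k \<in> u \<longleftrightarrow> k \<in> v then if k \<in> u \<longrightarrow> i k = j k then 1 else 0 else 0)" if "k \<in> K" for k
    using that mean orth iI[of k] jI[of k]
    by (cases "k \<in> u"; cases "k \<in> v") (simp_all add: h_def prob_space)
  show "?E = (if (u, i) = (v, j) then 1 else 0)"
  proof (cases "(u, i) = (v, j)")
    case True
    then show ?thesis unfolding prod_eq E(2) by (simp add: h_E)
  next
    case False
    have "\<exists>k\<in>K. expectation (\<lambda>\<omega>. h k (X \<omega> k)) = 0"
    proof (cases "u = v")
      case True
      then obtain k where "k \<in> u" "i k \<noteq> j k" using False PiE_ext[OF u(2), of j] v(2) by auto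
      then show ?thesis using True u(1) by (intro bexI[of _ k]) (auto simp: h_E)
    next
      case False
      then obtain k where "k \<in> u \<longleftrightarrow> k \<notin> v" by blast
      then show ?thesis using u(1) v(1) by (intro bexI[of _ k]) (auto simp: h_E)
    qed
    then show ?thesis
      unfolding prod_eq E(2) if_not_P[OF False] using assms(1) by (intro prod_zero) auto
  qed
qed

section \<open>Orthonormal projection\<close>

lemma integrable_mult_L2:
  fixes f g :: "'a \<Rightarrow> real"
  assumes "f \<in> borel_measurable M" "g \<in> borel_measurable M"
    and "integrable M (\<lambda>x. (f x)\<^sup>2)" "integrable M (\<lambda>x. (g x)\<^sup>2)"
  shows "integrable M (\<lambda>x. f x * g x)"
proof (rule Bochner_Integration.integrable_bound)
  show "integrable M (\<lambda>x. (f x)\<^sup>2 + (g x)\<^sup>2)" using assms(3,4) by simp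
  have "\<bar>f x * g x\<bar> \<le> (f x)\<^sup>2 + (g x)\<^sup>2" for x
  proof -
    have "2 * (\<bar>f x\<bar> * \<bar>g x\<bar>) \<le> \<bar>f x\<bar>\<^sup>2 + \<bar>g x\<bar>\<^sup>2"
      using sum_squares_bound[of "\<bar>f x\<bar>" "\<bar>g x\<bar>"] by simp
    moreover have "0 \<le> \<bar>f x\<bar> * \<bar>g x\<bar>" by simp
    ultimately show ?thesis unfolding abs_mult power2_abs by linarith
  qed
  then show "AE x in M. norm (f x * g x) \<le> norm ((f x)\<^sup>2 + (g x)\<^sup>2)" by (intro AE_I2) simp
qed (use assms in measurable)

text \<open>
The fluctuating part \<open>s\<close> of the projection satisfies \<open>\<E>[s\<^sup>2] = \<E>[Y s] = \<Sum> C\<^sup>2\<close>. Expanding the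
nonnegative quantity \<open>\<E>[(Y - \<E>[Y] - s)\<^sup>2]\<close> gives Bessel's inequality.
\<close>

lemma (in prob_space) orthonormal_projection_moments:
  fixes e :: "'b \<Rightarrow> 'a \<Rightarrow> real"
  assumes "finite A"
    and Y: "Y \<in> borel_measurable M" "integrable M (\<lambda>\<omega>. (Y \<omega>)\<^sup>2)"
    and e: "\<And>\<alpha>. \<alpha> \<in> A \<Longrightarrow> e \<alpha> \<in> borel_measurable M"
      "\<And>\<alpha>. \<alpha> \<in> A \<Longrightarrow> integrable M (\<lambda>\<omega>. (e \<alpha> \<omega>)\<^sup>2)"
    and mean: "\<And>\<alpha>. \<alpha> \<in> A \<Longrightarrow> expectation (e \<alpha>) = 0"
    and orth: "\<And>\<alpha> \<beta>. \<alpha> \<in> A \<Longrightarrow> \<beta> \<in> A \<Longrightarrow>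
      expectation (\<lambda>\<omega>. e \<alpha> \<omega> * e \<beta> \<omega>) = (if \<alpha> = \<beta> then 1 else 0)"
  defines "C \<equiv> \<lambda>\<alpha>. expectation (\<lambda>\<omega>. Y \<omega> * e \<alpha> \<omega>)"
  defines "T \<equiv> \<lambda>\<omega>. expectation Y + (\<Sum>\<alpha>\<in>A. C \<alpha> * e \<alpha> \<omega>)"
  shows "expectation T = expectation Y"
    and "variance T = (\<Sum>\<alpha>\<in>A. (C \<alpha>)\<^sup>2)"
    and "(\<Sum>\<alpha>\<in>A. (C \<alpha>)\<^sup>2) \<le> variance Y"
proof -
  define s where "s \<omega> = (\<Sum>\<alpha>\<in>A. C \<alpha> * e \<alpha> \<omega>)" for \<omega>
  let ?m = "expectation Y"
  have Y_int: "integrable M Y" by (rule square_integrable_imp_integrable[OF Y])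
  have e_int: "integrable M (e \<alpha>)" if "\<alpha> \<in> A" for \<alpha>
    by (rule square_integrable_imp_integrable[OF e[OF that]])
  have ee_int: "integrable M (\<lambda>\<omega>. e \<alpha> \<omega> * e \<beta> \<omega>)" if "\<alpha> \<in> A" "\<beta> \<in> A" for \<alpha> \<beta>
    by (intro integrable_mult_L2 e that)
  have Ye_int: "integrable M (\<lambda>\<omega>. Y \<omega> * e \<alpha> \<omega>)" if "\<alpha> \<in> A" for \<alpha>
    by (intro integrable_mult_L2 e Y that)
  have s: "integrable M s" "expectation s = 0"
    unfolding s_def using e_int mean by (simp_all add: Bochner_Integration.integral_sum)
  have s2_eq: "(s \<omega>)\<^sup>2 = (\<Sum>\<alpha>\<in>A. \<Sum>\<beta>\<in>A. C \<alpha> * C \<beta> * (e \<alpha> \<omega> * e \<beta> \<omega>))" for \<omega>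
    by (simp add: s_def power2_eq_square sum_product mult_ac)
  have s2: "integrable M (\<lambda>\<omega>. (s \<omega>)\<^sup>2)"
    unfolding s2_eq using ee_int by (intro Bochner_Integration.integrable_sum integrable_mult_right)
  have s2_E: "expectation (\<lambda>\<omega>. (s \<omega>)\<^sup>2) = (\<Sum>\<alpha>\<in>A. (C \<alpha>)\<^sup>2)"
  proof -
    have "expectation (\<lambda>\<omega>. (s \<omega>)\<^sup>2)
        = (\<Sum>\<alpha>\<in>A. \<Sum>\<beta>\<in>A. C \<alpha> * C \<beta> * expectation (\<lambda>\<omega>. e \<alpha> \<omega> * e \<beta> \<omega>))"
      unfolding s2_eq using ee_int by (simp add: Bochner_Integration.integral_sum)
    also have "\<dots> = (\<Sum>\<alpha>\<in>A. \<Sum>\<beta>\<in>A. if \<alpha> = \<beta> then (C \<alpha>)\<^sup>2 else 0)"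
      by (intro sum.cong refl) (auto simp: orth power2_eq_square)
    also have "\<dots> = (\<Sum>\<alpha>\<in>A. (C \<alpha>)\<^sup>2)" using assms(1) by simp
    finally show ?thesis .
  qed
  have Ys_eq: "Y \<omega> * s \<omega> = (\<Sum>\<alpha>\<in>A. C \<alpha> * (Y \<omega> * e \<alpha> \<omega>))" for \<omega>
    by (simp add: s_def sum_distrib_left mult_ac)
  have Ys: "integrable M (\<lambda>\<omega>. Y \<omega> * s \<omega>)"
    unfolding Ys_eq using Ye_int by (intro Bochner_Integration.integrable_sum integrable_mult_right)
  have Ys_E: "expectation (\<lambda>\<omega>. Y \<omega> * s \<omega>) = (\<Sum>\<alpha>\<in>A. (C \<alpha>)\<^sup>2)"
    unfolding Ys_eq using Ye_int
    by (simp add: Bochner_Integration.integral_sum C_def power2_eq_square)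
  have T: "T = (\<lambda>\<omega>. ?m + s \<omega>)" by (simp add: T_def s_def)
  show ET: "expectation T = ?m" unfolding T using s by (simp add: prob_space)
  show "variance T = (\<Sum>\<alpha>\<in>A. (C \<alpha>)\<^sup>2)" unfolding ET unfolding T using s2_E by simp
  have c2: "integrable M (\<lambda>\<omega>. (Y \<omega> - ?m)\<^sup>2)"
    using Y(2) Y_int by (simp add: power2_diff)
  have ms: "integrable M (\<lambda>\<omega>. (Y \<omega> - ?m) * s \<omega>)"
    "expectation (\<lambda>\<omega>. (Y \<omega> - ?m) * s \<omega>) = (\<Sum>\<alpha>\<in>A. (C \<alpha>)\<^sup>2)"
    using Ys s Ys_E by (simp_all add: left_diff_distrib)
  have "0 \<le> expectation (\<lambda>\<omega>. (Y \<omega> - ?m - s \<omega>)\<^sup>2)" by (intro Bochner_Integration.integral_nonneg) auto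
  also have "(\<lambda>\<omega>. (Y \<omega> - ?m - s \<omega>)\<^sup>2)
      = (\<lambda>\<omega>. (Y \<omega> - ?m)\<^sup>2 + (s \<omega>)\<^sup>2 - 2 * ((Y \<omega> - ?m) * s \<omega>))"
    by (intro ext) (simp add: power2_eq_square algebra_simps)
  also have "expectation \<dots> = variance Y - (\<Sum>\<alpha>\<in>A. (C \<alpha>)\<^sup>2)"
    using c2 s2 ms s2_E by simp
  finally show "(\<Sum>\<alpha>\<in>A. (C \<alpha>)\<^sup>2) \<le> variance Y" by simp
qed

section \<open>Second-moment properties of the SDD approximation\<close>

theorem mainTheorem5:
  fixes M :: "'w measure" and N S :: nat
    and a b :: "nat \<Rightarrow> real"
    and X :: "'w \<Rightarrow> nat \<Rightarrow> real"
    and f :: "nat \<Rightarrow> real \<Rightarrow> real"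
    and p n :: "nat \<Rightarrow> nat"
    and \<Xi> :: "nat \<Rightarrow> nat \<Rightarrow> real"
    and y :: "(nat \<Rightarrow> real) \<Rightarrow> real"
  assumes "prob_space M"
    and "1 \<le> N"
    and "\<And>k. k \<in> {1..N} \<Longrightarrow> a k < b k"
    and "X \<in> measurable M (Pi\<^sub>M {1..N} (\<lambda>k. restrict_space borel {a k..b k}))"
    and "prob_space.indep_vars M (\<lambda>_. borel) (\<lambda>k \<omega>. X \<omega> k) {1..N}"
    and "\<And>k x. k \<in> {1..N} \<Longrightarrow> 0 \<le> f k x"
    and "\<And>k. k \<in> {1..N} \<Longrightarrow> distributed M lborel (\<lambda>\<omega>. X \<omega> k) (\<lambda>x. ennreal (f k x))"
    and "\<And>k. k \<in> {1..N} \<Longrightarrow> continuous_on {a k..b k} (f k)"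
    and "\<And>k. k \<in> {1..N} \<Longrightarrow> closure {x. f k x \<noteq> 0} = {a k..b k}"
    and "\<And>k. k \<in> {1..N} \<Longrightarrow> open_knots (p k) (n k) (a k) (b k) (\<Xi> k)"
    and "1 \<le> S" and "S \<le> N"
    and "y \<in> borel_measurable (Pi\<^sub>M {1..N} (\<lambda>k. restrict_space borel {a k..b k}))"
    and "integrable M (\<lambda>\<omega>. (y (X \<omega>))\<^sup>2)"
  shows "prob_space.expectation M (\<lambda>\<omega>. sdd_approx M N X p n \<Xi> S y (X \<omega>)) = sdd_const M X y
    \<and> sdd_const M X y = prob_space.expectation M (\<lambda>\<omega>. y (X \<omega>))
    \<and> prob_space.variance M (\<lambda>\<omega>. sdd_approx M N X p n \<Xi> S y (X \<omega>)) =
        (\<Sum>u\<in>sdd_subsets N S. \<Sum>i\<in>multi_indices n u. (sdd_coeff M X p n \<Xi> y u i)\<^sup>2)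
    \<and> (\<Sum>u\<in>sdd_subsets N S. \<Sum>i\<in>multi_indices n u. (sdd_coeff M X p n \<Xi> y u i)\<^sup>2)
        \<le> prob_space.variance M (\<lambda>\<omega>. y (X \<omega>))"
proof -
  define K where "K = {1..N}"
  define \<psi> where "\<psi> k = ortho_bspline M (\<lambda>\<omega>. X \<omega> k) (p k) (n k) (\<Xi> k)" for k
  interpret prob_space M by fact
  have X_in: "X \<omega> k \<in> {a k..b k}" if "\<omega> \<in> space M" "k \<in> K" for \<omega> k
    using measurable_space[OF assms(4) that(1)] that(2)
    by (auto simp: space_PiM space_restrict_space PiE_iff K_def)
  have X_meas: "(\<lambda>\<omega>. X \<omega> k) \<in> borel_measurable M" if "k \<in> K" for k
    using assms(7)[of k] that by (simp add: K_def distributed_def)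
  have \<psi>_meas: "i \<in> {2..n k} \<Longrightarrow> \<psi> k i \<in> borel_measurable borel"
    and \<psi>_int: "i \<in> {2..n k} \<Longrightarrow> integrable M (\<lambda>\<omega>. \<psi> k i (X \<omega> k))"
      "i \<in> {2..n k} \<Longrightarrow> j \<in> {2..n k} \<Longrightarrow>
        integrable M (\<lambda>\<omega>. \<psi> k i (X \<omega> k) * \<psi> k j (X \<omega> k))"
    and \<psi>_mean: "i \<in> {2..n k} \<Longrightarrow> expectation (\<lambda>\<omega>. \<psi> k i (X \<omega> k)) = 0"
    and \<psi>_orth: "i \<in> {2..n k} \<Longrightarrow> j \<in> {2..n k} \<Longrightarrow>
        expectation (\<lambda>\<omega>. \<psi> k i (X \<omega> k) * \<psi> k j (X \<omega> k)) = (if i = j then 1 else 0)"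
    if "k \<in> K" for k i j
  proof -
    have k: "k \<in> {1..N}" using that by (simp add: K_def)
    have "(\<lambda>\<omega>. X \<omega> k) \<in> space M \<rightarrow> {a k..b k}" using X_in that by blast
    note o = ortho_bspline_orthonormal[OF assms(10)[OF k] assms(7)[OF k] assms(6)[OF k]
        assms(8)[OF k] assms(9)[OF k] this, folded \<psi>_def]
    show "i \<in> {2..n k} \<Longrightarrow> \<psi> k i \<in> borel_measurable borel" by (rule o(1)) simp
    show "i \<in> {2..n k} \<Longrightarrow> integrable M (\<lambda>\<omega>. \<psi> k i (X \<omega> k))" by (rule o(2)) simp
    show "i \<in> {2..n k} \<Longrightarrow> j \<in> {2..n k} \<Longrightarrow>
        integrable M (\<lambda>\<omega>. \<psi> k i (X \<omega> k) * \<psi> k j (X \<omega> k))" by (rule o(3)) simp_all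
    show "i \<in> {2..n k} \<Longrightarrow> expectation (\<lambda>\<omega>. \<psi> k i (X \<omega> k)) = 0" by (rule o(5))
    show "i \<in> {2..n k} \<Longrightarrow> j \<in> {2..n k} \<Longrightarrow>
        expectation (\<lambda>\<omega>. \<psi> k i (X \<omega> k) * \<psi> k j (X \<omega> k)) = (if i = j then 1 else 0)"
      by (rule o(4)) simp_all
  qed
  define A where "A = Sigma (sdd_subsets N S) (multi_indices n)"
  define e where "e = (\<lambda>(u, i) \<omega>. sdd_basis M X p n \<Xi> u i (X \<omega>))"
  define Y where "Y \<omega> = y (X \<omega>)" for \<omega>
  have e_eq: "e (u, i) \<omega> = (\<Prod>k\<in>u. \<psi> k (i k) (X \<omega> k))" for u i \<omega>
    by (simp add: e_def sdd_basis_def \<psi>_def)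
  have fin_sub: "finite (sdd_subsets N S)"
    by (rule finite_subset[of _ "Pow {1..N}"]) (auto simp: sdd_subsets_def)
  have fin_ind: "finite (multi_indices n u)" if "u \<in> sdd_subsets N S" for u
    unfolding multi_indices_def using that
    by (intro finite_PiE) (auto simp: sdd_subsets_def intro: finite_subset)
  have A_fin: "finite A" unfolding A_def using fin_sub fin_ind by (rule finite_SigmaI)
  have A_D: "fst \<alpha> \<noteq> {}" "fst \<alpha> \<subseteq> K" if "\<alpha> \<in> A" for \<alpha>
    using that by (auto simp: A_def sdd_subsets_def K_def)
  have A_D3: "snd \<alpha> \<in> (\<Pi>\<^sub>E k\<in>fst \<alpha>. {2..n k})" if "\<alpha> \<in> A" for \<alpha>
    using that by (cases \<alpha>) (simp add: A_def multi_indices_def)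
  have indep: "indep_vars (\<lambda>_. borel) (\<lambda>k \<omega>. X \<omega> k) K" using assms(5) by (simp add: K_def)
  have tensor:
    "integrable M (\<lambda>\<omega>. (\<Prod>k\<in>u. \<psi> k (i k) (X \<omega> k)) * (\<Prod>k\<in>v. \<psi> k (j k) (X \<omega> k)))"
    "expectation (\<lambda>\<omega>. (\<Prod>k\<in>u. \<psi> k (i k) (X \<omega> k)) * (\<Prod>k\<in>v. \<psi> k (j k) (X \<omega> k)))
       = (if (u, i) = (v, j) then 1 else 0)"
    if "u \<subseteq> K" "i \<in> (\<Pi>\<^sub>E k\<in>u. {2..n k})" "v \<subseteq> K" "j \<in> (\<Pi>\<^sub>E k\<in>v. {2..n k})" for u i v j
  proof -
    have "finite K" by (simp add: K_def)
    note T = tensor_product_orthonormal[where I = "\<lambda>k. {2..n k}", OF this indep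
        \<psi>_meas \<psi>_int \<psi>_mean \<psi>_orth that]
    show "integrable M (\<lambda>\<omega>. (\<Prod>k\<in>u. \<psi> k (i k) (X \<omega> k)) * (\<Prod>k\<in>v. \<psi> k (j k) (X \<omega> k)))"
      by (rule T(1))
    show "expectation (\<lambda>\<omega>. (\<Prod>k\<in>u. \<psi> k (i k) (X \<omega> k)) * (\<Prod>k\<in>v. \<psi> k (j k) (X \<omega> k)))
       = (if (u, i) = (v, j) then 1 else 0)"
      by (rule T(2))
  qed
  have e_meas: "e \<alpha> \<in> borel_measurable M" if "\<alpha> \<in> A" for \<alpha>
  proof -
    have "(\<lambda>\<omega>. \<psi> k (snd \<alpha> k) (X \<omega> k)) \<in> borel_measurable M" if "k \<in> fst \<alpha>" for k
    proof -
      have "k \<in> K" "snd \<alpha> k \<in> {2..n k}"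
        using A_D(2)[OF \<open>\<alpha> \<in> A\<close>] A_D3[OF \<open>\<alpha> \<in> A\<close>] that by auto
      then show ?thesis by (intro measurable_compose[OF X_meas \<psi>_meas])
    qed
    then show ?thesis by (cases \<alpha>) (auto simp: e_eq[abs_def] intro!: borel_measurable_prod)
  qed
  have e_sq: "integrable M (\<lambda>\<omega>. (e \<alpha> \<omega>)\<^sup>2)" if "\<alpha> \<in> A" for \<alpha>
    using tensor(1)[OF A_D(2)[OF that] A_D3[OF that] A_D(2)[OF that] A_D3[OF that]]
    by (cases \<alpha>) (simp add: e_eq power2_eq_square)
  have e_mean: "expectation (e \<alpha>) = 0" if "\<alpha> \<in> A" for \<alpha>
    \<comment> \<open>The empty tensor product is the constant 1; its only multi-index is undefined everywhere.\<close>
    using tensor(2)[OF A_D(2)[OF that] A_D3[OF that], of "{}" "\<lambda>_. undefined"] A_D(1)[OF that]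
    by (cases \<alpha>) (simp add: e_eq[abs_def])
  have e_orth: "expectation (\<lambda>\<omega>. e \<alpha> \<omega> * e \<beta> \<omega>) = (if \<alpha> = \<beta> then 1 else 0)"
    if "\<alpha> \<in> A" "\<beta> \<in> A" for \<alpha> \<beta>
    using tensor(2)[OF A_D(2)[OF that(1)] A_D3[OF that(1)] A_D(2)[OF that(2)] A_D3[OF that(2)]]
    by (cases \<alpha>; cases \<beta>) (simp add: e_eq)
  have Y_meas: "Y \<in> borel_measurable M"
    unfolding Y_def using measurable_compose[OF assms(4,13)] .
  have Y_sq: "integrable M (\<lambda>\<omega>. (Y \<omega>)\<^sup>2)" using assms(14) by (simp add: Y_def)
  note proj = orthonormal_projection_moments[OF A_fin Y_meas Y_sq e_meas e_sq e_mean e_orth]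
  have const: "sdd_const M X y = expectation Y" by (simp add: sdd_const_def Y_def[abs_def])
  have flat: "(\<Sum>u\<in>sdd_subsets N S. \<Sum>i\<in>multi_indices n u. g u i) = (\<Sum>\<alpha>\<in>A. g (fst \<alpha>) (snd \<alpha>))"
    for g :: "nat set \<Rightarrow> (nat \<Rightarrow> nat) \<Rightarrow> real"
    unfolding A_def using fin_sub fin_ind by (subst sum.Sigma) (auto simp: case_prod_beta)
  have coeff: "sdd_coeff M X p n \<Xi> y (fst \<alpha>) (snd \<alpha>) = expectation (\<lambda>\<omega>. Y \<omega> * e \<alpha> \<omega>)" for \<alpha>
    by (simp add: sdd_coeff_def Y_def e_def case_prod_beta)
  have approx: "sdd_approx M N X p n \<Xi> S y (X \<omega>)
      = expectation Y + (\<Sum>\<alpha>\<in>A. expectation (\<lambda>\<omega>. Y \<omega> * e \<alpha> \<omega>) * e \<alpha> \<omega>)" for \<omega>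
    unfolding sdd_approx_def flat const coeff by (simp add: e_def case_prod_beta)
  show ?thesis
    unfolding approx flat coeff const Y_def[symmetric]
    using proj by blast
qed

end
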